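(* For $j=1,\ldots,N$ and all $s\in\mathbb{C}$ with $\mathrm{Re}(s)\ge0$, $s\notin\{\lambda_k,2\lambda_k:k=1,\ldots,N\}$, $$Z_j(s;\theta)=\frac{\lambda_j}{\lambda_j-s}\sum_{i=1}^Np_{i,j}\Big(\beta_i^*(s)-\frac{\theta s}{2\lambda_j-s}g_i^*(s)\Big)Z_i(as;\theta)-s\sum_{i=1}^Np_{i,j}\Big[\frac{\theta}{2\lambda_j-s}g_i^*(2\lambda_j)Z_i(2a\lambda_j;\theta)+\frac{\beta_i^*(\lambda_j)-\theta g_i^*(\lambda_j)}{\lambda_j-s}Z_i(a\lambda_j;\theta)\Big].$$ In matrix notation, with $\tilde Z(s;\theta)=(Z_1(s;\theta),\ldots,Z_N(s;\theta))^T$, $$\tilde Z(s;\theta)=U(s;\theta)\tilde Z(as;\theta)+\tilde K(s;\theta),$$ where $$U(s;\theta)=L_1(s)\big[P^TB^*(s)+\theta(I-L_2(s))P^TG^*(s)\big],\qquad \tilde K(s;\theta)=(I-L_1(s))\tilde v^{(1)}+(I-L_2(s))\tilde v^{(2)},$$ and $\tilde v^{(k)}=(v_1^{(k)},\ldots,v_N^{(k)})^T$, $k=1,2$, with $$v_j^{(1)}=\sum_{i=1}^Np_{i,j}\big(\beta_i^*(\lambda_j)-\theta g_i^*(\lambda_j)\big)Z_i(a\lambda_j;\theta),\qquad v_j^{(2)}=\theta\sum_{i=1}^Np_{i,j}\,g_i^*(2\lambda_j)\,Z_i(2a\lambda_j;\theta).$$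
   Context: Let $E=\{1,\ldots,N\}$, $a\in(0,1)$, $\theta\in[-1,1]$. $(Y_n)_{n\ge0}$ is an irreducible discrete-time Markov chain on $E$ with transition matrix $P=(p_{i,j})$ and stationary distribution $\tilde\pi=(\pi_1,\ldots,\pi_N)^T$. The nonnegative process $W_n$ satisfies $W_{n+1}=[aW_n+S_n-A_{n+1}]^+$, $[x]^+=\max(0,x)$. Given $Y_n$, the triple $(A_{n+1},S_n,Y_{n+1})$ is independent of the past (in particular of $W_n$), and $$P(A_{n+1}\le x,S_n\le y,Y_{n+1}=j\mid Y_n=i)=p_{i,j}\,C_\theta^{FGM}(F_{S,i}(y),F_{A,j}(x)),\quad x,y\ge0,$$ where $C_\theta^{FGM}(u_1,u_2)=u_1u_2+\theta u_1u_2(1-u_1)(1-u_2)$ is the Farlie–Gumbel–Morgenstern copula, $F_{S,i}$ is a distribution function on $[0,\infty)$ with density $f_{S,i}$, and $F_{A,j}(x)=1-e^{-\lambda_jx}$, $\lambda_j>0$. Thus, given $Y_n=i,Y_{n+1}=j$, $(S_n,A_{n+1})$ has density $f_{S,i}(y)\lambda_je^{-\lambda_jx}+\theta g_i(y)[2\lambda_je^{-2\lambda_jx}-\lambda_je^{-\lambda_jx}]$, where $g_i(y)=f_{S,i}(y)(1-2F_{S,i}(y))$. Notation: $\beta_i^*(s)=\int_0^\infty e^{-sy}f_{S,i}(y)dy$, $g_i^*(s)=\int_0^\infty e^{-sy}g_i(y)dy$, $B^*(s)=\mathrm{diag}(\beta_1^*(s),\ldots,\beta_N^*(s))$, $G^*(s)=\mathrm{diag}(g_1^*(s),\ldots,g_N^*(s))$,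 $L_k(s)=\mathrm{diag}\big(\frac{k\lambda_1}{k\lambda_1-s},\ldots,\frac{k\lambda_N}{k\lambda_N-s}\big)$, $k=1,2$, $I$ the $N\times N$ identity. For $\mathrm{Re}(s)\ge0$, $Z_i(s;\theta)=\lim_{n\to\infty}E(e^{-sW_n}1_{\{Y_n=i\}})$ in the model with parameter $\theta$; it is assumed that these limits exist and are the transforms $E(e^{-sW}1_{\{Y=i\}})$ of a steady-state pair $(W,Y)$ with $W$ finite and $P(Y=i)=\pi_i$. *)

theory Defs
  imports "HOL-Probability.Probability"
begin

definition fgm_copula :: "real \<Rightarrow> real \<Rightarrow> real \<Rightarrow> real" where
  "fgm_copula \<theta> u v = u * v + \<theta> * u * v * (1 - u) * (1 - v)"

definition density_cdf :: "(real \<Rightarrow> real) \<Rightarrow> real \<Rightarrow> real" where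
  "density_cdf f = cdf (density lborel (\<lambda>y. ennreal (f y)))"

definition exp_cdf :: "real \<Rightarrow> real \<Rightarrow> real" where
  "exp_cdf l x = 1 - exp (- l * x)"

definition stochastic_matrix :: "real ^ 'n ^ 'n \<Rightarrow> bool" where
  "stochastic_matrix P \<longleftrightarrow> (\<forall>i j. 0 \<le> P $ i $ j) \<and> (\<forall>i. (\<Sum>j\<in>UNIV. P $ i $ j) = 1)"

text \<open>Powers are spelled out with \<open>**\<close>: the product \<open>*\<close> on vector types is componentwise.\<close>

definition irreducible_matrix :: "real ^ 'n ^ 'n \<Rightarrow> bool" where
  "irreducible_matrix P \<longleftrightarrow> (\<forall>i j. \<exists>n::nat. 0 < (((**) P ^^ n) (mat 1)) $ i $ j)"

definition stationary_distribution :: "real ^ 'n ^ 'n \<Rightarrow> real ^ 'n \<Rightarrow> bool" where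
  "stationary_distribution P p \<longleftrightarrow>
     (\<forall>i. 0 \<le> p $ i) \<and> (\<Sum>i\<in>UNIV. p $ i) = 1 \<and> p v* P = p"

definition markov_chain :: "'a measure \<Rightarrow> real ^ 'n ^ 'n \<Rightarrow> (nat \<Rightarrow> 'a \<Rightarrow> 'n) \<Rightarrow> bool" where
  "markov_chain M P Y \<longleftrightarrow>
     (\<forall>n. Y n \<in> measurable M (count_space UNIV)) \<and>
     (\<forall>n y j. measure M {\<omega> \<in> space M. \<forall>k\<le>n. Y k \<omega> = y k} > 0 \<longrightarrow>
        \<P>(\<omega> in M. Y (Suc n) \<omega> = j \<bar> \<forall>k\<le>n. Y k \<omega> = y k) = P $ (y n) $ j)"

text \<open>
  The events determined by everything that has happened when the triple
  \<open>(A (Suc n), S n, Y (Suc n))\<close> is drawn. Interarrival times are indexed from 1; \<open>A 0\<close> plays no role.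
\<close>

definition past_events ::
  "'a measure \<Rightarrow> (nat \<Rightarrow> 'a \<Rightarrow> real) \<Rightarrow> (nat \<Rightarrow> 'a \<Rightarrow> real) \<Rightarrow> (nat \<Rightarrow> 'a \<Rightarrow> real)
     \<Rightarrow> (nat \<Rightarrow> 'a \<Rightarrow> 'n) \<Rightarrow> nat \<Rightarrow> 'a set set" where
  "past_events M W S A Y n = sigma_sets (space M)
     ({W k -` B \<inter> space M | k B. k \<le> n \<and> B \<in> sets borel} \<union>
      {Y k -` C \<inter> space M | k C. k \<le> n} \<union>
      {S k -` B \<inter> space M | k B. k < n \<and> B \<in> sets borel} \<union>
      {A k -` B \<inter> space M | k B. 1 \<le> k \<and> k \<le> n \<and> B \<in> sets borel})"

definition triple_events ::
  "'a measure \<Rightarrow> (nat \<Rightarrow> 'a \<Rightarrow> real) \<Rightarrow> (nat \<Rightarrow> 'a \<Rightarrow> real) \<Rightarrow> (nat \<Rightarrow> 'a \<Rightarrow> 'n)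
     \<Rightarrow> nat \<Rightarrow> 'a set set" where
  "triple_events M S A Y n =
     {(\<lambda>\<omega>. (A (Suc n) \<omega>, S n \<omega>, Y (Suc n) \<omega>)) -` B \<inter> space M | B.
        B \<in> sets (borel \<Otimes>\<^sub>M borel \<Otimes>\<^sub>M count_space UNIV)}"

definition joint_transform ::
  "'a measure \<Rightarrow> ('a \<Rightarrow> real) \<Rightarrow> ('a \<Rightarrow> 'n) \<Rightarrow> 'n \<Rightarrow> complex \<Rightarrow> complex" where
  "joint_transform M X V i s =
     (LINT \<omega>|M. exp (- s * complex_of_real (X \<omega>)) * of_bool (V \<omega> = i))"

definition Z ::
  "'a measure \<Rightarrow> (nat \<Rightarrow> 'a \<Rightarrow> real) \<Rightarrow> (nat \<Rightarrow> 'a \<Rightarrow> 'n) \<Rightarrow> 'n \<Rightarrow> complex \<Rightarrow> complex" where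
  "Z M W Y i s = lim (\<lambda>n. joint_transform M (W n) (Y n) i s)"

text \<open>
  Conditioning on \<open>Y n = i\<close> is required only when this event has positive probability.
  Independence given \<open>Y n = i\<close> is independence under the measure conditioned on that event.
\<close>

locale fgm_queue = prob_space M
  for M :: "'a measure"
  and a \<theta> :: real
  and P :: "real ^ 'n ^ 'n"
  and p :: "real ^ 'n"
  and f :: "'n \<Rightarrow> real \<Rightarrow> real"
  and lam :: "'n \<Rightarrow> real"
  and W S A :: "nat \<Rightarrow> 'a \<Rightarrow> real"
  and Y :: "nat \<Rightarrow> 'a \<Rightarrow> 'n" +
  assumes a: "0 < a" "a < 1"
    and theta: "-1 \<le> \<theta>" "\<theta> \<le> 1"
    and stochastic: "stochastic_matrix P"
    and irreducible: "irreducible_matrix P"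
    and stationary: "stationary_distribution P p"
    and lam_pos: "\<And>i. 0 < lam i"
    and f_borel: "\<And>i. f i \<in> borel_measurable borel"
    and f_nonneg: "\<And>i y. 0 \<le> f i y"
    and f_support: "\<And>i y. y < 0 \<Longrightarrow> f i y = 0"
    and f_prob: "\<And>i. prob_space (density lborel (\<lambda>y. ennreal (f i y)))"
    and W_measurable: "\<And>n. W n \<in> borel_measurable M"
    and S_measurable: "\<And>n. S n \<in> borel_measurable M"
    and A_measurable: "\<And>n. A (Suc n) \<in> borel_measurable M"
    and markov: "markov_chain M P Y"
    and W_nonneg: "\<And>n. AE \<omega> in M. 0 \<le> W n \<omega>"
    and recursion: "\<And>n. AE \<omega> in M. W (Suc n) \<omega> = max 0 (a * W n \<omega> + S n \<omega> - A (Suc n) \<omega>)"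
    and cond_indep: "\<And>n i. prob {\<omega> \<in> space M. Y n \<omega> = i} > 0 \<Longrightarrow>
      prob_space.indep_set (uniform_measure M {\<omega> \<in> space M. Y n \<omega> = i})
        (past_events M W S A Y n) (triple_events M S A Y n)"
    and cond_law: "\<And>n i j x y. prob {\<omega> \<in> space M. Y n \<omega> = i} > 0 \<Longrightarrow> 0 \<le> x \<Longrightarrow> 0 \<le> y \<Longrightarrow>
      \<P>(\<omega> in M. A (Suc n) \<omega> \<le> x \<and> S n \<omega> \<le> y \<and> Y (Suc n) \<omega> = j \<bar> Y n \<omega> = i)
        = P $ i $ j * fgm_copula \<theta> (density_cdf (f i) y) (exp_cdf (lam j) x)"

text \<open>The steady-state pair may live on a probability space of its own.\<close>

locale fgm_queue_steady = fgm_queue M a \<theta> P p f lam W S A Y + steady: prob_space M'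
  for M :: "'a measure"
  and a \<theta> :: real
  and P :: "real ^ 'n ^ 'n"
  and p :: "real ^ 'n"
  and f :: "'n \<Rightarrow> real \<Rightarrow> real"
  and lam :: "'n \<Rightarrow> real"
  and W S A :: "nat \<Rightarrow> 'a \<Rightarrow> real"
  and Y :: "nat \<Rightarrow> 'a \<Rightarrow> 'n"
  and M' :: "'b measure"
  and Winf :: "'b \<Rightarrow> real"
  and Yinf :: "'b \<Rightarrow> 'n" +
  assumes Winf_measurable: "Winf \<in> borel_measurable M'"
    and Yinf_measurable: "Yinf \<in> measurable M' (count_space UNIV)"
    and Winf_nonneg: "AE \<omega> in M'. 0 \<le> Winf \<omega>"
    and Yinf_law: "\<And>i. measure M' {\<omega> \<in> space M'. Yinf \<omega> = i} = p $ i"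
    and transform_limit: "\<And>i s. 0 \<le> Re s \<Longrightarrow>
      (\<lambda>n. joint_transform M (W n) (Y n) i s) \<longlonglongrightarrow> joint_transform M' Winf Yinf i s"

definition laplace_transform :: "(real \<Rightarrow> real) \<Rightarrow> complex \<Rightarrow> complex" where
  "laplace_transform h s =
     (LINT y:{0..}|lborel. exp (- s * complex_of_real y) * complex_of_real (h y))"

definition beta_star :: "('n \<Rightarrow> real \<Rightarrow> real) \<Rightarrow> 'n \<Rightarrow> complex \<Rightarrow> complex" where
  "beta_star f i = laplace_transform (f i)"

definition g_star :: "('n \<Rightarrow> real \<Rightarrow> real) \<Rightarrow> 'n \<Rightarrow> complex \<Rightarrow> complex" where
  "g_star f i = laplace_transform (\<lambda>y. f i y * (1 - 2 * density_cdf (f i) y))"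

definition diag_matrix :: "('n \<Rightarrow> complex) \<Rightarrow> complex ^ 'n ^ 'n" where
  "diag_matrix d = (\<chi> i j. if i = j then d i else 0)"

definition B_star :: "('n \<Rightarrow> real \<Rightarrow> real) \<Rightarrow> complex \<Rightarrow> complex ^ 'n ^ 'n" where
  "B_star f s = diag_matrix (\<lambda>i. beta_star f i s)"

definition G_star :: "('n \<Rightarrow> real \<Rightarrow> real) \<Rightarrow> complex \<Rightarrow> complex ^ 'n ^ 'n" where
  "G_star f s = diag_matrix (\<lambda>i. g_star f i s)"

definition L :: "('n \<Rightarrow> real) \<Rightarrow> nat \<Rightarrow> complex \<Rightarrow> complex ^ 'n ^ 'n" where
  "L lam k s =
     diag_matrix (\<lambda>i. of_nat k * complex_of_real (lam i) / (of_nat k * complex_of_real (lam i) - s))"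

definition U ::
  "real \<Rightarrow> real ^ 'n ^ 'n \<Rightarrow> ('n \<Rightarrow> real \<Rightarrow> real) \<Rightarrow> ('n \<Rightarrow> real) \<Rightarrow> complex \<Rightarrow> complex ^ 'n ^ 'n" where
  "U \<theta> P f lam s =
     (let PT = transpose (map_matrix complex_of_real P) in
       L lam 1 s ** (PT ** B_star f s + \<theta> *\<^sub>R ((mat 1 - L lam 2 s) ** PT ** G_star f s)))"

text \<open>In the next three definitions \<open>z\<close> stands for the family of steady-state transforms.\<close>

definition v1 ::
  "real \<Rightarrow> real \<Rightarrow> real ^ 'n ^ 'n \<Rightarrow> ('n \<Rightarrow> real \<Rightarrow> real) \<Rightarrow> ('n \<Rightarrow> real)
     \<Rightarrow> ('n \<Rightarrow> complex \<Rightarrow> complex) \<Rightarrow> complex ^ 'n" where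
  "v1 a \<theta> P f lam z = (\<chi> j. \<Sum>i\<in>UNIV. complex_of_real (P $ i $ j) *
     (beta_star f i (complex_of_real (lam j)) - complex_of_real \<theta> * g_star f i (complex_of_real (lam j))) *
     z i (complex_of_real (a * lam j)))"

definition v2 ::
  "real \<Rightarrow> real \<Rightarrow> real ^ 'n ^ 'n \<Rightarrow> ('n \<Rightarrow> real \<Rightarrow> real) \<Rightarrow> ('n \<Rightarrow> real)
     \<Rightarrow> ('n \<Rightarrow> complex \<Rightarrow> complex) \<Rightarrow> complex ^ 'n" where
  "v2 a \<theta> P f lam z = (\<chi> j. complex_of_real \<theta> * (\<Sum>i\<in>UNIV. complex_of_real (P $ i $ j) *
     g_star f i (complex_of_real (2 * lam j)) * z i (complex_of_real (2 * a * lam j))))"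

definition K ::
  "real \<Rightarrow> real \<Rightarrow> real ^ 'n ^ 'n \<Rightarrow> ('n \<Rightarrow> real \<Rightarrow> real) \<Rightarrow> ('n \<Rightarrow> real)
     \<Rightarrow> ('n \<Rightarrow> complex \<Rightarrow> complex) \<Rightarrow> complex \<Rightarrow> complex ^ 'n" where
  "K a \<theta> P f lam z s =
     (mat 1 - L lam 1 s) *v v1 a \<theta> P f lam z + (mat 1 - L lam 2 s) *v v2 a \<theta> P f lam z"

end

theory Submission
  imports Defs
begin

text \<open>
  The identity already holds before the limit: for every \<open>n\<close>, the transforms of \<open>(W (n+1), Y (n+1))\<close>
  are the stated linear combination of the transforms of \<open>(W n, Y n)\<close>
  (\<open>joint_transform_Suc\<close>). All coefficients are independent of \<open>n\<close>, so letting \<open>n\<close> tend to infinity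
  gives the fixed-point equation for \<open>Z\<close>, whose matrix form is linear algebra with diagonal matrices.

  For the step from \<open>n\<close> to \<open>n+1\<close>, condition on \<open>Y n = i\<close>. Then \<open>W n\<close> is independent of the triple
  \<open>(A (n+1), S n, Y (n+1))\<close>, so one may fix a value \<open>w\<close> of \<open>W n\<close>, average
  \<open>exp (- s * max 0 (a * w + S n - A (n+1)))\<close> over the triple, and average over \<open>w\<close> afterwards. The FGM copula is
  \<open>u v + \<theta> (u - u\<^sup>2) (v - v\<^sup>2)\<close>. With \<open>u = F\<close> the distribution function of a density \<open>f\<close>, the factor \<open>u - u\<^sup>2\<close>
  is the distribution function of the signed density \<open>f (1 - 2 F)\<close>; with \<open>v = 1 - exp (- \<lambda> x)\<close>, the factor \<open>v - v\<^sup>2\<close>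
  is \<open>exp (- \<lambda> x) - exp (- 2 \<lambda> x)\<close>, the difference of the exponential distribution functions with rates
  \<open>2 \<lambda>\<close> and \<open>\<lambda>\<close>. Hence, on the event \<open>Y (n+1) = j\<close>, the pair \<open>(A (n+1), S n)\<close> has a density
  which is a sum of products of exponential densities and functions of the service time
  (\<open>conditional_law_eq_density\<close>).

  Against an exponential density of rate \<open>k\<close>, the transform of \<open>max 0 (z - x)\<close> is a combination of
  \<open>exp (- s z)\<close> and \<open>exp (- k z)\<close> (\<open>integral_exponential_density_waiting\<close>). With \<open>z = a * w + y\<close> and \<open>k\<close> equal to
  \<open>\<lambda>\<close> or \<open>2 \<lambda>\<close>, these exponentials split into a factor in \<open>y\<close>, which integrates to \<open>\<beta>\<^sup>*\<close> or \<open>g\<^sup>*\<close>, and a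
  factor in \<open>w\<close>, which averages to a transform of \<open>W n\<close>; this is where the arguments \<open>a s\<close>, \<open>a \<lambda>\<close> and
  \<open>2 a \<lambda>\<close> come from.
\<close>

section \<open>Laws on the plane and exponential waiting\<close>

text \<open>
  The quadrants are the sets \<open>{..c}\<close> for the componentwise order on pairs; they are closed under
  intersection and generate the Borel sets of the plane.
\<close>

lemma measure_eqI_atMost_rectangles:
  fixes \<mu> \<nu> :: "(real \<times> real) measure"
  assumes "finite_measure \<mu>"
    and sets: "sets \<mu> = sets (borel \<Otimes>\<^sub>M borel)" "sets \<nu> = sets (borel \<Otimes>\<^sub>M borel)"
    and eq: "\<And>x y. emeasure \<mu> ({..x} \<times> {..y}) = emeasure \<nu> ({..x} \<times> {..y})"
  shows "\<mu> = \<nu>"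
proof (rule measure_eqI_generator_eq[where \<Omega> = UNIV and E = "range (\<lambda>c::real \<times> real. {..c})"
      and A = "\<lambda>n. {..(real n, real n)}"])
  have rect: "{..(x, y)} = {..x} \<times> {..y}" for x y :: real
    by auto
  interpret finite_measure \<mu> by fact
  have E: "{..c} \<inter> {..d} = {..inf c d}" for c d :: "real \<times> real"
    by auto
  show "Int_stable (range (\<lambda>c::real \<times> real. {..c}))"
    unfolding Int_stable_def by (auto simp: E)
  show "emeasure \<mu> X = emeasure \<nu> X" if "X \<in> range (\<lambda>c. {..c})" for X
    using that eq by (auto simp: rect)
  have borel: "sets (borel \<Otimes>\<^sub>M borel :: (real \<times> real) measure)
      = sigma_sets UNIV (range (\<lambda>c. {..c}))"
    unfolding borel_prod borel_eq_atMost[where 'a = "real \<times> real"] by (rule sets_measure_of) simp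
  show "sets \<mu> = sigma_sets UNIV (range (\<lambda>c. {..c}))" "sets \<nu> = sigma_sets UNIV (range (\<lambda>c. {..c}))"
    using sets borel by simp_all
  have "(x, y) \<in> (\<Union>n. {..(real n, real n)})" for x y
    using real_arch_simple[of "max x y"] by auto
  then show "(\<Union>n. {..(real n, real n)}) = UNIV"
    by auto
qed (auto simp: finite_measure.emeasure_finite assms(1))

text \<open>
  The transform of the waiting time \<open>max 0 (z - x)\<close> after an exponential time \<open>x\<close>. On \<open>x \<le> z\<close> the
  integrand is an exponential with an explicit antiderivative; the part \<open>x > z\<close>, where the waiting time is zero,
  contributes the tail probability \<open>exp (- l z)\<close>.
\<close>

lemma integral_exponential_density_waiting:
  fixes s :: complex
  assumes l: "0 < l" and s: "s \<noteq> of_real l" and z: "0 \<le> z"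
  shows "(LINT x|lborel. of_real (exponential_density l x) * exp (- s * of_real (max 0 (z - x))))
    = of_real l / (of_real l - s) * exp (- s * of_real z)
      - s / (of_real l - s) * exp (- of_real l * of_real z)"
proof -
  define c where "c = complex_of_real l"
  have cs: "s - c \<noteq> 0" using s by (auto simp: c_def)
  interpret E: prob_space "density lborel (exponential_density l)"
    by (rule prob_space_exponential_density[OF l])
  have tail: "has_bochner_integral lborel
      (\<lambda>x. complex_of_real (indicator {z<..} x * exponential_density l x)) (exp (- c * of_real z))"
  proof -
    have "has_bochner_integral lborel (\<lambda>x. indicator {z<..} x * exponential_density l x) (exp (- l * z))"
    proof (rule has_bochner_integral_nn_integral)
      have "(\<integral>\<^sup>+ x. ennreal (indicator {z<..} x * exponential_density l x) \<partial>lborel)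
          = emeasure (density lborel (exponential_density l)) {z<..}"
        by (subst emeasure_density)
          (auto intro!: nn_integral_cong split: split_indicator)
      also have "\<dots> = E.prob (space (density lborel (exponential_density l)) - {..z})"
        by (subst E.emeasure_eq_measure) (auto intro!: arg_cong[where f = E.prob])
      also have "\<dots> = ennreal (1 - measure (density lborel (exponential_density l)) {..z})"
        by (subst E.prob_compl) auto
      also have "measure (density lborel (exponential_density l)) {..z} = 1 - exp (- l * z)"
        using emeasure_erlang_density[OF l, of 0 z] l z
        by (simp add: measure_def erlang_CDF_0)
      finally show "(\<integral>\<^sup>+ x. ennreal (indicator {z<..} x * exponential_density l x) \<partial>lborel)
        = ennreal (exp (- l * z))" by simp
    qed (use l in \<open>auto simp: exponential_density_nonneg\<close>)
    then have "has_bochner_integral lborel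
        (\<lambda>x. complex_of_real (indicator {z<..} x * exponential_density l x)) (of_real (exp (- l * z)))"
      by (rule has_bochner_integral_of_real)
    then show ?thesis
      by (simp add: c_def exp_of_real[symmetric])
  qed
  have head: "has_bochner_integral lborel
      (\<lambda>x. indicator {0..z} x *\<^sub>R (c * exp (- s * of_real z) * exp ((s - c) * of_real x)))
      (c / (s - c) * exp (- s * of_real z) * exp ((s - c) * of_real z)
        - c / (s - c) * exp (- s * of_real z) * exp ((s - c) * of_real 0))"
  proof (rule has_bochner_integral_FTC_Icc[OF z])
    fix x
    have "((\<lambda>w. c / (s - c) * exp (- s * of_real z) * exp ((s - c) * w)) has_field_derivative
        c * exp (- s * of_real z) * exp ((s - c) * of_real x)) (at (of_real x))"
      using cs by (auto intro!: derivative_eq_intros)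
    from has_vector_derivative_real_field[OF this]
    show "((\<lambda>x. c / (s - c) * exp (- s * of_real z) * exp ((s - c) * of_real x)) has_vector_derivative
        c * exp (- s * of_real z) * exp ((s - c) * of_real x)) (at x within {0..z})"
      by (simp add: o_def)
  qed (intro continuous_intros)
  have "(LINT x|lborel. of_real (exponential_density l x) * exp (- s * of_real (max 0 (z - x))))
     = (LINT x|lborel. indicator {0..z} x *\<^sub>R (c * exp (- s * of_real z) * exp ((s - c) * of_real x))
         + complex_of_real (indicator {z<..} x * exponential_density l x))"
    by (rule Bochner_Integration.integral_cong)
      (use z in \<open>auto simp: exponential_density_def c_def algebra_simps max_def exp_of_real[symmetric]
         mult_exp_exp split: split_indicator\<close>)
  also have "\<dots> = (c / (s - c) * exp (- s * of_real z) * exp ((s - c) * of_real z)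
        - c / (s - c) * exp (- s * of_real z) * exp ((s - c) * of_real 0)) + exp (- c * of_real z)"
    using has_bochner_integral_add[OF head tail] by (rule has_bochner_integral_integral_eq)
  also have "exp (- s * of_real z) * exp ((s - c) * of_real z) = exp (- c * of_real z)"
    by (simp add: mult_exp_exp algebra_simps)
  then have "c / (s - c) * exp (- s * of_real z) * exp ((s - c) * of_real z) = c / (s - c) * exp (- c * of_real z)"
    by (simp add: mult.assoc)
  also have "c / (s - c) * exp (- c * of_real z) - c / (s - c) * exp (- s * of_real z) * exp ((s - c) * of_real 0)
       + exp (- c * of_real z)
     = c / (c - s) * exp (- s * of_real z) - s / (c - s) * exp (- c * of_real z)"
    using cs by (simp add: divide_simps) (simp add: algebra_simps)
  finally show ?thesis by (simp add: c_def)
qed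

text \<open>
  Stated with \<open>erlang_CDF 0\<close>, which agrees with \<open>exp_cdf\<close> on the nonnegative half-line and vanishes
  on the negative one, so that quadrants with negative corners need no separate treatment.
\<close>

lemma integral_exponential_density_atMost:
  assumes l: "0 < l"
  shows "integrable lborel (exponential_density l)"
    and "(LINT x|lborel. exponential_density l x * indicator {..x0} x) = erlang_CDF 0 l x0"
proof -
  interpret E: prob_space "density lborel (exponential_density l)"
    by (rule prob_space_exponential_density[OF l])
  have nn: "\<And>x. 0 \<le> exponential_density l x" using l by (rule exponential_density_nonneg)
  show "integrable lborel (exponential_density l)"
    using E.emeasure_space_1 nn
    by (intro integrableI_nn_integral_finite[where x = 1]) (auto simp: emeasure_density)
  have "(LINT x|lborel. exponential_density l x * indicator {..x0} x)
      = enn2real (\<integral>\<^sup>+ x. ennreal (exponential_density l x * indicator {..x0} x) \<partial>lborel)"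
    by (rule integral_eq_nn_integral) (auto simp: nn)
  also have "(\<integral>\<^sup>+ x. ennreal (exponential_density l x * indicator {..x0} x) \<partial>lborel)
      = (\<integral>\<^sup>+ x. ennreal (exponential_density l x) * indicator {..x0} x \<partial>lborel)"
    by (auto intro!: nn_integral_cong split: split_indicator)
  also have "\<dots> = ennreal (erlang_CDF 0 l x0)"
    by (rule nn_integral_erlang_density[OF l])
  finally show "(LINT x|lborel. exponential_density l x * indicator {..x0} x) = erlang_CDF 0 l x0"
    using l by (simp add: erlang_CDF_0)
qed

section \<open>Service-time densities and their tilts\<close>

text \<open>
  The chain rule \<open>\<integral> F dF = F\<^sup>2 / 2\<close> for a distribution function that may fail to be differentiable. Split the
  square \<open>{..y} \<times> {..y}\<close>, of mass \<open>F(y)\<^sup>2\<close>, along the diagonal: slicing each half in the appropriate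
  direction gives the same integral, because without atoms open and closed half-lines have equal mass.
\<close>

lemma (in real_distribution) integral_cdf_atMost:
  assumes atomless: "\<And>x. measure M {x} = 0"
  shows "(LINT u|M. cdf M u * indicator {..y} u) = (cdf M y)\<^sup>2 / 2"
proof -
  interpret MM: pair_sigma_finite M M ..
  have [measurable]: "cdf M \<in> borel_measurable borel"
    by (intro borel_measurable_mono monoI cdf_nondecreasing)
  define I where "I = (LINT u|M. cdf M u * indicator {..y} u)"
  have int: "integrable M (\<lambda>u. cdf M u * indicator {..y} u)"
    by (rule integrable_const_bound[where B = 1])
      (auto simp: cdf_nonneg cdf_bounded_prob split: split_indicator)
  have I: "(\<integral>\<^sup>+ u. ennreal (cdf M u * indicator {..y} u) \<partial>M) = ennreal I"
    unfolding I_def by (rule nn_integral_eq_integral[OF int]) (auto simp: cdf_nonneg)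
  have below: "emeasure M {..<v} = ennreal (cdf M v)" for v
  proof -
    have "cdf M v = measure M {..<v} + measure M {v}"
      unfolding cdf_def by (subst finite_measure_Union[symmetric]) (auto intro!: arg_cong[where f = prob])
    then show ?thesis by (simp add: emeasure_eq_measure atomless)
  qed
  let ?lower = "{(u, v). v \<le> u \<and> u \<le> y}" and ?upper = "{(u, v). u < v \<and> v \<le> y}"
  have meas: "{x \<in> space (M \<Otimes>\<^sub>M M). snd x \<le> fst x \<and> fst x \<le> y} \<in> sets (M \<Otimes>\<^sub>M M)"
    "{x \<in> space (M \<Otimes>\<^sub>M M). fst x < snd x \<and> snd x \<le> y} \<in> sets (M \<Otimes>\<^sub>M M)"
    by measurable
  have sets [measurable]: "?lower \<in> sets (M \<Otimes>\<^sub>M M)" "?upper \<in> sets (M \<Otimes>\<^sub>M M)"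
    using meas by (auto simp: space_pair_measure case_prod_unfold)
  have "emeasure (M \<Otimes>\<^sub>M M) ?lower = (\<integral>\<^sup>+ u. emeasure M (Pair u -` ?lower) \<partial>M)"
    by (rule emeasure_pair_measure_alt) measurable
  also have "\<dots> = (\<integral>\<^sup>+ u. ennreal (cdf M u * indicator {..y} u) \<partial>M)"
  proof (rule nn_integral_cong)
    fix u
    have "Pair u -` ?lower = (if u \<le> y then {..u} else {})" by auto
    then show "emeasure M (Pair u -` ?lower) = ennreal (cdf M u * indicator {..y} u)"
      by (simp add: emeasure_eq_measure cdf_def)
  qed
  finally have lower: "emeasure (M \<Otimes>\<^sub>M M) ?lower = ennreal I" by (simp add: I)
  have "emeasure (M \<Otimes>\<^sub>M M) ?upper = (\<integral>\<^sup>+ v. emeasure M ((\<lambda>u. (u, v)) -` ?upper) \<partial>M)"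
    by (rule MM.emeasure_pair_measure_alt2) measurable
  also have "\<dots> = (\<integral>\<^sup>+ u. ennreal (cdf M u * indicator {..y} u) \<partial>M)"
  proof (rule nn_integral_cong)
    fix v
    have "(\<lambda>u. (u, v)) -` ?upper = (if v \<le> y then {..<v} else {})" by auto
    then show "emeasure M ((\<lambda>u. (u, v)) -` ?upper) = ennreal (cdf M v * indicator {..y} v)"
      by (simp add: below)
  qed
  finally have upper: "emeasure (M \<Otimes>\<^sub>M M) ?upper = ennreal I" by (simp add: I)
  have I_nonneg: "0 \<le> I"
    unfolding I_def by (rule integral_nonneg_AE) (simp add: cdf_nonneg)
  have "ennreal (cdf M y * cdf M y) = emeasure (M \<Otimes>\<^sub>M M) ({..y} \<times> {..y})"
    by (subst emeasure_pair_measure_Times)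
      (auto simp: emeasure_eq_measure cdf_def ennreal_mult)
  also have "{..y} \<times> {..y} = ?lower \<union> ?upper" by auto
  also have "emeasure (M \<Otimes>\<^sub>M M) (?lower \<union> ?upper) = ennreal I + ennreal I"
    by (subst plus_emeasure[symmetric, OF sets]) (auto simp: lower upper)
  also have "\<dots> = ennreal (2 * I)"
    using I_nonneg by (simp flip: ennreal_plus)
  finally have "cdf M y * cdf M y = 2 * I"
    using I_nonneg by (subst (asm) ennreal_inj) (auto simp: cdf_nonneg)
  then show ?thesis by (simp add: I_def power2_eq_square)
qed

text \<open>
  The derivative of \<open>F (1 - F)\<close> for \<open>F\<close> the distribution function of \<open>f\<close>; its Laplace transform is
  \<open>g\<^sup>*\<close>.
\<close>

definition tilted_density :: "(real \<Rightarrow> real) \<Rightarrow> real \<Rightarrow> real" where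
  "tilted_density f y = f y * (1 - 2 * density_cdf f y)"

locale lifetime_density =
  fixes f :: "real \<Rightarrow> real"
  assumes borel [measurable]: "f \<in> borel_measurable borel"
    and nonneg: "\<And>y. 0 \<le> f y"
    and support: "\<And>y. y < 0 \<Longrightarrow> f y = 0"
    and prob: "prob_space (density lborel (\<lambda>y. ennreal (f y)))"
begin

abbreviation g :: "real \<Rightarrow> real" where
  "g \<equiv> tilted_density f"

sublocale law: real_distribution "density lborel (\<lambda>y. ennreal (f y))"
  using prob by (simp add: real_distribution_def real_distribution_axioms_def)

lemma cdf_range: "0 \<le> density_cdf f y" "density_cdf f y \<le> 1"
  by (simp_all add: density_cdf_def law.cdf_nonneg law.cdf_bounded_prob)

lemma cdf_borel [measurable]: "density_cdf f \<in> borel_measurable borel"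
  unfolding density_cdf_def by (intro borel_measurable_mono monoI law.cdf_nondecreasing)

lemma integrable_f: "integrable lborel f"
  using law.emeasure_space_1 nonneg
  by (intro integrableI_nn_integral_finite[where x = 1]) (auto simp: emeasure_density)

lemma g_borel [measurable]: "g \<in> borel_measurable borel"
  unfolding tilted_density_def[abs_def] by measurable

lemma abs_g_le: "\<bar>g y\<bar> \<le> f y"
  using cdf_range[of y] nonneg[of y] by (auto simp: tilted_density_def abs_mult intro!: mult_left_le)

lemma integrable_g: "integrable lborel g"
  by (rule Bochner_Integration.integrable_bound[OF integrable_f])
    (use nonneg in \<open>auto simp: abs_g_le intro: order_trans[OF abs_g_le]\<close>)

lemma integral_f_atMost: "(LINT y|lborel. f y * indicator {..y0} y) = density_cdf f y0"
proof -
  have "(LINT y|lborel. f y * indicator {..y0} y)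
      = (LINT y|density lborel (\<lambda>y. ennreal (f y)). indicator {..y0} y)"
    by (subst integral_density) (auto simp: nonneg)
  also have "\<dots> = density_cdf f y0"
    by (simp add: density_cdf_def cdf_def)
  finally show ?thesis .
qed

text \<open>
  Writing \<open>g = f - 2 f F\<close>, the second term integrates to \<open>F\<^sup>2\<close>.
\<close>

lemma integral_g_atMost:
  "(LINT y|lborel. g y * indicator {..y0} y) = density_cdf f y0 * (1 - density_cdf f y0)"
proof -
  let ?D = "density lborel (\<lambda>y. ennreal (f y))"
  have atomless: "measure ?D {x} = 0" for x
  proof -
    have "AE y in lborel. y \<noteq> x" by (rule AE_lborel_singleton)
    then have "emeasure ?D {x} = 0"
      by (subst emeasure_density) (auto intro!: nn_integral_0_iff_AE[THEN iffD2] split: split_indicator)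
    then show ?thesis by (simp add: measure_def)
  qed
  have "(LINT y|lborel. g y * indicator {..y0} y)
      = (LINT y|?D. (1 - 2 * density_cdf f y) * indicator {..y0} y)"
    by (subst integral_density) (auto simp: nonneg tilted_density_def mult.assoc)
  also have "\<dots> = (LINT y|?D. indicator {..y0} y - 2 * (density_cdf f y * indicator {..y0} y))"
    by (simp add: algebra_simps)
  also have "\<dots> = (LINT y|?D. indicator {..y0} y) - (LINT y|?D. 2 * (density_cdf f y * indicator {..y0} y))"
    by (intro Bochner_Integration.integral_diff integrable_mult_right law.integrable_const_bound[where B = 1])
      (auto simp: cdf_range split: split_indicator)
  also have "\<dots> = density_cdf f y0 - (density_cdf f y0)\<^sup>2"
    using law.integral_cdf_atMost[OF atomless, of y0] by (simp add: density_cdf_def cdf_def)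
  finally show ?thesis by (simp add: power2_eq_square algebra_simps)
qed

lemma cdf_eq_0: "y \<le> 0 \<Longrightarrow> density_cdf f y = 0"
proof -
  assume y: "y \<le> 0"
  have "AE u in lborel. u \<noteq> (0::real)" by (rule AE_lborel_singleton)
  then have "AE u in lborel. f u * indicator {..y} u = 0"
    by eventually_elim (use y in \<open>auto simp: support split: split_indicator\<close>)
  then show ?thesis
    unfolding integral_f_atMost[symmetric] by (subst integral_cong_AE[where g = "\<lambda>_. 0"]) auto
qed

lemma integral_f_exp:
  assumes s: "0 \<le> Re s"
  shows "integrable lborel (\<lambda>y. of_real (f y) * exp (- s * of_real y))"
    and "(LINT y|lborel. of_real (f y) * exp (- s * of_real y)) = laplace_transform f s"
    and "integrable lborel (\<lambda>y. of_real (g y) * exp (- s * of_real y))"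
    and "(LINT y|lborel. of_real (g y) * exp (- s * of_real y)) = laplace_transform g s"
proof -
  have gz: "y < 0 \<Longrightarrow> g y = 0" for y by (simp add: tilted_density_def support)
  have *: "norm (of_real (h y) * exp (- s * of_real y)) \<le> f y"
    if "\<And>y. \<bar>h y\<bar> \<le> f y" for y and h :: "real \<Rightarrow> real"
  proof (cases "y < 0")
    case True with that[of y] support[of y] show ?thesis by simp
  next
    case False
    with s that[of y] nonneg[of y] have "\<bar>h y\<bar> * exp (- (Re s * y)) \<le> f y * 1"
      by (intro mult_mono) (auto intro!: mult_nonneg_nonneg)
    then show ?thesis by (simp add: norm_mult)
  qed
  show "integrable lborel (\<lambda>y. of_real (f y) * exp (- s * of_real y))"
    by (rule Bochner_Integration.integrable_bound[OF integrable_f])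
      (use *[of f] nonneg in \<open>auto\<close>)
  show "integrable lborel (\<lambda>y. of_real (g y) * exp (- s * of_real y))"
    by (rule Bochner_Integration.integrable_bound[OF integrable_f])
      (use *[of g] nonneg abs_g_le in \<open>auto\<close>)
  show "(LINT y|lborel. of_real (f y) * exp (- s * of_real y)) = laplace_transform f s"
    unfolding laplace_transform_def set_lebesgue_integral_def
    by (rule Bochner_Integration.integral_cong) (auto simp: support split: split_indicator)
  show "(LINT y|lborel. of_real (g y) * exp (- s * of_real y)) = laplace_transform g s"
    unfolding laplace_transform_def set_lebesgue_integral_def
    by (rule Bochner_Integration.integral_cong) (auto simp: gz split: split_indicator)
qed

end

section \<open>The density of the FGM copula with an exponential marginal\<close>

lemma integrable_lborel_pair_mult:
  fixes u v :: "real \<Rightarrow> real"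
  assumes u: "integrable lborel u" and v: "integrable lborel v"
  shows "integrable (lborel \<Otimes>\<^sub>M lborel) (\<lambda>(x, y). u x * v y)"
proof (rule lborel_pair.Fubini_integrable)
  note [measurable] = borel_measurable_integrable[OF u] borel_measurable_integrable[OF v]
  show "(\<lambda>(x, y). u x * v y) \<in> borel_measurable (lborel \<Otimes>\<^sub>M lborel)"
    by measurable
  show "integrable lborel (\<lambda>x. \<integral>y. norm (case (x, y) of (x, y) \<Rightarrow> u x * v y) \<partial>lborel)"
    using u by (simp add: abs_mult)
  show "AE x in lborel. integrable lborel (\<lambda>y. case (x, y) of (x, y) \<Rightarrow> u x * v y)"
    using v by simp
qed

lemma integral_lborel_pair_mult:
  fixes u v :: "real \<Rightarrow> real"
  assumes u: "integrable lborel u" and v: "integrable lborel v"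
  shows "(LINT (x, y)|(lborel \<Otimes>\<^sub>M lborel). u x * v y) = (LINT x|lborel. u x) * (LINT y|lborel. v y)"
  by (subst lborel_pair.integral_fst[OF integrable_lborel_pair_mult[OF u v], symmetric]) simp

lemma norm_exp_neg_mult_le_1:
  "0 \<le> Re s \<Longrightarrow> 0 \<le> w \<Longrightarrow> norm (exp (- s * complex_of_real w)) \<le> 1"
  by simp

text \<open>The joint density of \<open>(A, S)\<close> at \<open>(x, y)\<close>, with the exponential variable first.\<close>

definition fgm_density :: "real \<Rightarrow> (real \<Rightarrow> real) \<Rightarrow> real \<Rightarrow> real \<Rightarrow> real \<Rightarrow> real" where
  "fgm_density \<theta> f l x y = exponential_density l x * f y
     + \<theta> * ((exponential_density (2 * l) x - exponential_density l x) * tilted_density f y)"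

context lifetime_density
begin

lemma fgm_density_borel [measurable]:
  "(\<lambda>(x, y). fgm_density \<theta> f l x y) \<in> borel_measurable (borel \<Otimes>\<^sub>M borel)"
  unfolding fgm_density_def by measurable

text \<open>
  Both factors of the correction are dominated by the marginals: \<open>\<bar>g\<bar> \<le> f\<close>, and with \<open>q = exp (- l x)\<close> the
  exponential factor is \<open>l q (2 q - 1)\<close>, at most \<open>l q\<close> in absolute value. So the bound \<open>\<bar>\<theta>\<bar> \<le> 1\<close> is
  exactly what makes the correction smaller than the product density.
\<close>

lemma fgm_density_nonneg:
  assumes l: "0 < l" and \<theta>: "-1 \<le> \<theta>" "\<theta> \<le> 1"
  shows "0 \<le> fgm_density \<theta> f l x y"
proof -
  let ?e = "exponential_density l x"
  let ?k = "exponential_density (2 * l) x - exponential_density l x"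
  have k: "\<bar>?k\<bar> \<le> ?e"
  proof (cases "x < 0")
    case False
    define q where "q = exp (- x * l)"
    have "0 \<le> q" "q \<le> 1" using False l by (auto simp: q_def)
    moreover have "exp (- x * (2 * l)) = q * q"
      by (simp add: q_def flip: exp_add)
    ultimately have "?k = l * (q * (2 * q - 1))" "?e = l * q"
      using False by (simp_all add: exponential_density_def q_def algebra_simps)
    moreover have "\<bar>q * (2 * q - 1)\<bar> \<le> q * 1"
      unfolding abs_mult using \<open>0 \<le> q\<close> \<open>q \<le> 1\<close> by (intro mult_mono) auto
    ultimately show ?thesis using l by (simp add: abs_mult)
  qed (simp add: exponential_density_def)
  have "\<bar>\<theta> * (?k * g y)\<bar> \<le> 1 * (?e * f y)"
    unfolding abs_mult using k abs_g_le[of y] \<theta> nonneg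
    by (intro mult_mono) (auto intro: order_trans[OF _ k])
  then show ?thesis
    unfolding fgm_density_def by linarith
qed

lemma integrable_fgm_density:
  assumes l: "0 < l"
  shows "integrable (lborel \<Otimes>\<^sub>M lborel) (\<lambda>(x, y). fgm_density \<theta> f l x y)"
proof -
  have "integrable lborel (exponential_density l)" "integrable lborel (exponential_density (2 * l))"
    using l by (auto intro: integral_exponential_density_atMost(1))
  then have "integrable (lborel \<Otimes>\<^sub>M lborel)
     (\<lambda>z. (case z of (x, y) \<Rightarrow> exponential_density l x * f y)
      + \<theta> * (case z of (x, y) \<Rightarrow> (exponential_density (2 * l) x - exponential_density l x) * g y))"
    by (intro Bochner_Integration.integrable_add integrable_mult_right integrable_lborel_pair_mult
        integrable_f integrable_g Bochner_Integration.integrable_diff)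
  then show ?thesis
    by (simp add: fgm_density_def case_prod_unfold)
qed

text \<open>
  The integrand is a sum of two products, so its integral is computed by one-dimensional integrals; the
  exponential factor of the correction gives \<open>V - V\<^sup>2\<close> since the exponential tail with rate \<open>2 l\<close> is the square
  of the tail with rate \<open>l\<close>.
\<close>

lemma integral_fgm_density_rectangle:
  assumes l: "0 < l"
  shows "(LINT z|(lborel \<Otimes>\<^sub>M lborel). (case z of (x, y) \<Rightarrow> fgm_density \<theta> f l x y) * indicator ({..x0} \<times> {..y0}) z)
    = fgm_copula \<theta> (density_cdf f y0) (erlang_CDF 0 l x0)"
proof -
  let ?F = "density_cdf f y0" and ?V = "erlang_CDF 0 l x0"
  define e where "e k x = exponential_density (k * l) x * indicator {..x0} x" for k x
  define f' where "f' y = f y * indicator {..y0} y" for y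
  define g' where "g' y = g y * indicator {..y0} y" for y
  have e: "integrable lborel (e k)" "(LINT x|lborel. e k x) = erlang_CDF 0 (k * l) x0" if "0 < k" for k
    using integral_exponential_density_atMost[of "k * l"] l that
    by (auto simp: e_def[abs_def] intro!: integrable_real_mult_indicator)
  have f': "integrable lborel f'" "(LINT y|lborel. f' y) = ?F"
    and g': "integrable lborel g'" "(LINT y|lborel. g' y) = ?F * (1 - ?F)"
    using integrable_f integrable_g
    by (auto simp: f'_def[abs_def] g'_def[abs_def] integral_f_atMost integral_g_atMost
        intro!: integrable_real_mult_indicator)
  have k: "integrable lborel (\<lambda>x. e 2 x - e 1 x)"
    "(LINT x|lborel. e 2 x - e 1 x) = erlang_CDF 0 (2 * l) x0 - ?V"
    using e[of 1] e[of 2] by auto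
  have "(LINT z|(lborel \<Otimes>\<^sub>M lborel). (case z of (x, y) \<Rightarrow> fgm_density \<theta> f l x y) * indicator ({..x0} \<times> {..y0}) z)
    = (LINT z|(lborel \<Otimes>\<^sub>M lborel). (case z of (x, y) \<Rightarrow> e 1 x * f' y)
        + \<theta> * (case z of (x, y) \<Rightarrow> (e 2 x - e 1 x) * g' y))"
    by (rule Bochner_Integration.integral_cong)
      (auto simp: fgm_density_def e_def f'_def g'_def indicator_times algebra_simps)
  also have "\<dots> = (LINT (x, y)|(lborel \<Otimes>\<^sub>M lborel). e 1 x * f' y)
      + \<theta> * (LINT (x, y)|(lborel \<Otimes>\<^sub>M lborel). (e 2 x - e 1 x) * g' y)"
    using integrable_lborel_pair_mult[OF e(1)[of 1] f'(1)] integrable_lborel_pair_mult[OF k(1) g'(1)]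
    by simp
  also have "\<dots> = ?V * ?F + \<theta> * ((erlang_CDF 0 (2 * l) x0 - ?V) * (?F * (1 - ?F)))"
    using e[of 1] f' g' k by (simp add: integral_lborel_pair_mult)
  also have "erlang_CDF 0 (2 * l) x0 - ?V = ?V * (1 - ?V)"
  proof (cases "0 \<le> x0")
    case True
    have "exp (- (2 * l) * x0) = exp (- l * x0) * exp (- l * x0)"
      by (simp flip: exp_add)
    with True show ?thesis by (simp add: erlang_CDF_0 algebra_simps)
  qed (simp add: erlang_CDF_0)
  finally show ?thesis by (simp add: fgm_copula_def algebra_simps)
qed

lemma emeasure_fgm_density_rectangle:
  assumes l: "0 < l" and \<theta>: "-1 \<le> \<theta>" "\<theta> \<le> 1" and c: "0 \<le> c"
  shows "emeasure (density (lborel \<Otimes>\<^sub>M lborel) (\<lambda>(x, y). ennreal (c * fgm_density \<theta> f l x y))) ({..x0} \<times> {..y0})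
    = ennreal (c * fgm_copula \<theta> (density_cdf f y0) (erlang_CDF 0 l x0))"
proof -
  have int: "integrable (lborel \<Otimes>\<^sub>M lborel)
      (\<lambda>z. c * ((case z of (x, y) \<Rightarrow> fgm_density \<theta> f l x y) * indicator ({..x0} \<times> {..y0}) z))"
    by (intro integrable_mult_right integrable_real_mult_indicator integrable_fgm_density[OF l])
      (auto intro!: pair_measureI)
  have "emeasure (density (lborel \<Otimes>\<^sub>M lborel) (\<lambda>(x, y). ennreal (c * fgm_density \<theta> f l x y))) ({..x0} \<times> {..y0})
    = (\<integral>\<^sup>+ z. (case z of (x, y) \<Rightarrow> ennreal (c * fgm_density \<theta> f l x y)) * indicator ({..x0} \<times> {..y0}) z
        \<partial>(lborel \<Otimes>\<^sub>M lborel))"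
    by (rule emeasure_density) (auto intro!: pair_measureI)
  also have "\<dots> = (\<integral>\<^sup>+ z. ennreal (c * ((case z of (x, y) \<Rightarrow> fgm_density \<theta> f l x y) * indicator ({..x0} \<times> {..y0}) z))
      \<partial>(lborel \<Otimes>\<^sub>M lborel))"
    by (rule nn_integral_cong) (auto split: split_indicator)
  also have "\<dots> = ennreal (LINT z|(lborel \<Otimes>\<^sub>M lborel).
      c * ((case z of (x, y) \<Rightarrow> fgm_density \<theta> f l x y) * indicator ({..x0} \<times> {..y0}) z))"
    by (rule nn_integral_eq_integral[OF int]) (auto simp: fgm_density_nonneg[OF l \<theta>] c)
  finally show ?thesis
    by (simp add: integral_fgm_density_rectangle[OF l])
qed

text \<open>
  One step of the recursion with \<open>z = a * w\<close> for a fixed workload \<open>w\<close>. Integrating first over the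
  interarrival time \<open>x\<close> leaves exponentials in \<open>z + y\<close>, which factor; the integral over \<open>y\<close> then yields the
  Laplace transforms of \<open>f\<close> and \<open>g\<close> at \<open>s\<close>, \<open>l\<close> and \<open>2 l\<close>.
\<close>

lemma integral_fgm_density_waiting:
  assumes l: "0 < l"
    and s: "0 \<le> Re s" "s \<noteq> of_real l" "s \<noteq> of_real (2 * l)" and z: "0 \<le> z"
  shows "(LINT (x, y)|(lborel \<Otimes>\<^sub>M lborel). of_real (fgm_density \<theta> f l x y) * exp (- s * of_real (max 0 (z + y - x))))
    = of_real l / (of_real l - s) *
        (laplace_transform f s - of_real \<theta> * s / (of_real (2 * l) - s) * laplace_transform g s) *
        exp (- s * of_real z)
      - s * (of_real \<theta> / (of_real (2 * l) - s) * laplace_transform g (of_real (2 * l)) *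
               exp (- of_real (2 * l) * of_real z)
             + (laplace_transform f (of_real l) - of_real \<theta> * laplace_transform g (of_real l)) /
               (of_real l - s) * exp (- of_real l * of_real z))"
proof -
  define h where "h x y = exp (- s * complex_of_real (max 0 (z + y - x)))" for x y
  have [measurable]: "(\<lambda>(x, y). h x y) \<in> borel_measurable (borel \<Otimes>\<^sub>M borel)"
    unfolding h_def by measurable
  have h_le: "norm (h x y) \<le> 1" for x y
    unfolding h_def by (rule norm_exp_neg_mult_le_1[OF s(1)]) simp
  have int: "integrable (lborel \<Otimes>\<^sub>M lborel) (\<lambda>(x, y). of_real (fgm_density \<theta> f l x y) * h x y)"
  proof (rule Bochner_Integration.integrable_bound[OF integrable_fgm_density[OF l, of \<theta>]])
    show "AE z in lborel \<Otimes>\<^sub>M lborel. norm (case z of (x, y) \<Rightarrow> of_real (fgm_density \<theta> f l x y) * h x y)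
        \<le> norm (case z of (x, y) \<Rightarrow> fgm_density \<theta> f l x y)"
      using h_le by (intro always_eventually) (auto simp: norm_mult intro!: mult_left_le)
  qed measurable
  \<comment> \<open>\<open>\<phi> k w\<close> is the transform of the waiting time from level \<open>w\<close> against rate \<open>k\<close>.\<close>
  define \<phi> where "\<phi> k w = of_real k / (of_real k - s) * exp (- s * of_real w)
      - s / (of_real k - s) * exp (- of_real k * of_real w)" for k w
  have inner: "(LINT x|lborel. of_real (fgm_density \<theta> f l x y) * h x y)
     = of_real (f y) * \<phi> l (z + y) + of_real \<theta> * (of_real (g y) * (\<phi> (2 * l) (z + y) - \<phi> l (z + y)))" for y
  proof (cases "y < 0")
    case True
    then show ?thesis by (simp add: fgm_density_def tilted_density_def support)
  next
    case False
    with z have zy: "0 \<le> z + y" by simp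
    have ie: "integrable lborel (\<lambda>x. of_real (exponential_density k x) * h x y)" if "0 < k" for k
    proof (rule Bochner_Integration.integrable_bound[OF integral_exponential_density_atMost(1)[OF that]])
      show "AE x in lborel. norm (complex_of_real (exponential_density k x) * h x y) \<le> norm (exponential_density k x)"
        using h_le by (intro always_eventually) (auto simp: norm_mult intro!: mult_left_le)
    qed measurable
    have e: "(LINT x|lborel. of_real (exponential_density k x) * h x y) = \<phi> k (z + y)"
      if "0 < k" "s \<noteq> of_real k" for k
      using integral_exponential_density_waiting[OF that zy] by (simp add: h_def \<phi>_def)
    have "(LINT x|lborel. of_real (fgm_density \<theta> f l x y) * h x y)
      = (LINT x|lborel. of_real (f y) * (of_real (exponential_density l x) * h x y)
          + of_real \<theta> * (of_real (g y) * (of_real (exponential_density (2 * l) x) * h x y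
              - of_real (exponential_density l x) * h x y)))"
      by (rule Bochner_Integration.integral_cong) (auto simp: fgm_density_def algebra_simps)
    also have "\<dots> = of_real (f y) * (LINT x|lborel. of_real (exponential_density l x) * h x y)
          + of_real \<theta> * (of_real (g y) * ((LINT x|lborel. of_real (exponential_density (2 * l) x) * h x y)
              - (LINT x|lborel. of_real (exponential_density l x) * h x y)))"
      using ie[of l] ie[of "2 * l"] l by simp
    finally show ?thesis using e[of l] e[of "2 * l"] l s by simp
  qed
  define c where "c k = complex_of_real k / (of_real k - s)" for k
  define d where "d k = s / (complex_of_real k - s)" for k
  define E where "E r = exp (- r * complex_of_real z)" for r
  define t where "t = complex_of_real \<theta>"
  define Ff where "Ff r y = complex_of_real (f y) * exp (- r * of_real y)" for r y
  define Gg where "Gg r y = complex_of_real (g y) * exp (- r * of_real y)" for r y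
  have tr: "integrable lborel (Ff r)" "(LINT y|lborel. Ff r y) = laplace_transform f r"
    "integrable lborel (Gg r)" "(LINT y|lborel. Gg r y) = laplace_transform g r" if "0 \<le> Re r" for r
    using integral_f_exp[OF that] by (simp_all add: Ff_def[abs_def] Gg_def[abs_def])
  have re: "0 \<le> Re (complex_of_real l)" "0 \<le> Re (complex_of_real (2 * l))" using l by auto
  have "(LINT (x, y)|(lborel \<Otimes>\<^sub>M lborel). of_real (fgm_density \<theta> f l x y) * h x y)
     = (LINT y|lborel. LINT x|lborel. of_real (fgm_density \<theta> f l x y) * h x y)"
    by (rule lborel_pair.integral_snd[OF int, symmetric])
  also have "\<dots> = (LINT y|lborel. c l * E s * Ff s y - d l * E (of_real l) * Ff (of_real l) y
      + (t * (c (2 * l) - c l) * E s * Gg s y - t * d (2 * l) * E (of_real (2 * l)) * Gg (of_real (2 * l)) y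
         + t * d l * E (of_real l) * Gg (of_real l) y))"
    unfolding inner
    by (rule Bochner_Integration.integral_cong)
      (auto simp: \<phi>_def c_def d_def E_def t_def Ff_def Gg_def ring_distribs exp_add exp_diff exp_minus field_simps)
  also have "\<dots> = c l * E s * laplace_transform f s - d l * E (of_real l) * laplace_transform f (of_real l)
      + (t * (c (2 * l) - c l) * E s * laplace_transform g s
         - t * d (2 * l) * E (of_real (2 * l)) * laplace_transform g (of_real (2 * l))
         + t * d l * E (of_real l) * laplace_transform g (of_real l))"
    using tr[OF s(1)] tr[OF re(1)] tr[OF re(2)] by simp
  \<comment> \<open>The two coefficients of the tilted part at \<open>exp (- s z)\<close> combine into one fraction.\<close>
  also have "c (2 * l) - c l = - c l * (s / (of_real (2 * l) - s))"
  proof -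
    have "complex_of_real l - s \<noteq> 0" "2 * complex_of_real l - s \<noteq> 0" using s by auto
    then show ?thesis by (simp add: c_def divide_simps) (simp add: algebra_simps)
  qed
  also have "c l * E s * Fs - d l * E1 * Fl + (t * (- c l * q) * E s * Gs - t * d (2 * l) * E2 * G2 + t * d l * E1 * Gl)
     = c l * (Fs - t * q * Gs) * E s - (t * d (2 * l) * G2 * E2 + d l * (Fl - t * Gl) * E1)"
    for Fs Fl Gs G2 Gl E1 E2 q by (simp add: algebra_simps)
  finally show ?thesis
    unfolding h_def E_def t_def c_def d_def by (simp add: distrib_left mult_ac)
qed

end

section \<open>One step of the queue\<close>

text \<open>
  Elementary conditioning, with the probability multiplied out so that expectations under the conditioned
  measure turn into the restricted expectations that define \<open>joint_transform\<close>.
\<close>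

lemma (in prob_space) integral_uniform_measure_times_prob:
  fixes h :: "'a \<Rightarrow> complex"
  assumes B: "B \<in> events" "0 < prob B" and [measurable]: "h \<in> borel_measurable M"
  shows "of_real (prob B) * (LINT \<omega>|uniform_measure M B. h \<omega>) = (LINT \<omega>|M. h \<omega> * of_bool (\<omega> \<in> B))"
proof -
  note [measurable] = B(1)
  have "uniform_measure M B = density M (\<lambda>\<omega>. ennreal (indicator B \<omega> / prob B))"
    unfolding uniform_measure_def
  proof (rule density_cong)
    have "indicator B \<omega> / emeasure M B = ennreal (indicator B \<omega> / prob B)" for \<omega>
      using B(2) by (simp add: emeasure_eq_measure divide_ennreal[symmetric] ennreal_indicator)
    then show "AE \<omega> in M. indicator B \<omega> / emeasure M B = ennreal (indicator B \<omega> / prob B)"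
      by simp
  qed measurable
  then have "(LINT \<omega>|uniform_measure M B. h \<omega>) = (LINT \<omega>|M. (indicator B \<omega> / prob B) *\<^sub>R h \<omega>)"
    by (simp add: integral_density)
  also have "of_real (prob B) * \<dots> = (LINT \<omega>|M. of_real (prob B) * ((indicator B \<omega> / prob B) *\<^sub>R h \<omega>))"
    by (rule integral_mult_right_zero[symmetric])
  also have "\<dots> = (LINT \<omega>|M. h \<omega> * of_bool (\<omega> \<in> B))"
    by (rule Bochner_Integration.integral_cong) (use B in \<open>auto simp: scaleR_conv_of_real split: split_indicator\<close>)
  finally show ?thesis .
qed

context fgm_queue
begin

lemma lifetime: "lifetime_density (f i)"
  by (rule lifetime_density.intro[OF f_borel f_nonneg f_support f_prob])

lemma Y_measurable [measurable]: "Y n \<in> measurable M (count_space UNIV)"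
  using markov by (simp add: markov_chain_def)

declare W_measurable [measurable] S_measurable [measurable] A_measurable [measurable]

text \<open>
  Given \<open>Y n = i\<close>, the law of \<open>(A (n+1), S n)\<close> restricted to the event \<open>Y (n+1) = j\<close>. The model prescribes its
  values only on quadrants with a corner \<open>(x, y)\<close>, \<open>x, y \<ge> 0\<close>. On the others both sides vanish: such a
  quadrant lies in one whose corner has a zero coordinate, and there the copula is already zero.
\<close>

lemma conditional_law_eq_density:
  assumes pos: "0 < prob {\<omega> \<in> space M. Y n \<omega> = i}"
  shows "distr (density (uniform_measure M {\<omega> \<in> space M. Y n \<omega> = i})
             (\<lambda>\<omega>. indicator {\<omega> \<in> space M. Y (Suc n) \<omega> = j} \<omega>))
           (borel \<Otimes>\<^sub>M borel) (\<lambda>\<omega>. (A (Suc n) \<omega>, S n \<omega>))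
    = density (lborel \<Otimes>\<^sub>M lborel) (\<lambda>(x, y). ennreal (P $ i $ j * fgm_density \<theta> (f i) (lam j) x y))"
    (is "?\<mu> = ?\<nu>")
proof -
  interpret F: lifetime_density "f i" by (rule lifetime)
  define Q where "Q = uniform_measure M {\<omega> \<in> space M. Y n \<omega> = i}"
  have [measurable_cong, simp]: "sets Q = sets M" "space Q = space M" by (simp_all add: Q_def)
  interpret Q: prob_space Q
    unfolding Q_def by (rule prob_space_uniform_measure) (use pos in \<open>auto simp: emeasure_eq_measure\<close>)
  have P_nonneg: "0 \<le> P $ i $ j" using stochastic unfolding stochastic_matrix_def by blast
  let ?G = "\<lambda>x y. fgm_copula \<theta> (density_cdf (f i) y) (erlang_CDF 0 (lam j) x)"
  define R where "R x y = {\<omega> \<in> space M. A (Suc n) \<omega> \<le> x \<and> S n \<omega> \<le> y \<and> Y (Suc n) \<omega> = j}" for x y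
  have [measurable]: "R x y \<in> sets M" for x y unfolding R_def by measurable
  have quadrant: "Q.prob (R x y) = P $ i $ j * ?G x y" if "0 \<le> x" "0 \<le> y" for x y
  proof -
    have "Q.prob (R x y) = \<P>(\<omega> in M. A (Suc n) \<omega> \<le> x \<and> S n \<omega> \<le> y \<and> Y (Suc n) \<omega> = j \<bar> Y n \<omega> = i)"
      unfolding Q_def R_def
      using measure_uniform_measure_eq_cond_prob[of
          "\<lambda>\<omega>. A (Suc n) \<omega> \<le> x \<and> S n \<omega> \<le> y \<and> Y (Suc n) \<omega> = j" "\<lambda>\<omega>. Y n \<omega> = i"]
      by simp
    also have "\<dots> = P $ i $ j * ?G x y"
      unfolding cond_law[OF pos that] using that(1) by (simp add: erlang_CDF_0 exp_cdf_def)
    finally show ?thesis .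
  qed
  have law: "Q.prob (R x y) = P $ i $ j * ?G x y" for x y
  proof (cases "0 \<le> x \<and> 0 \<le> y")
    case False
    then have G: "?G x y = 0"
      by (auto simp: fgm_copula_def erlang_CDF_0 F.cdf_eq_0)
    have "Q.prob (R x y) \<le> Q.prob (R (max 0 x) (max 0 y))"
      by (rule Q.finite_measure_mono) (auto simp: R_def)
    also have "\<dots> = P $ i $ j * ?G (max 0 x) (max 0 y)"
      by (rule quadrant) auto
    also have "\<dots> = 0"
      using False by (auto simp: fgm_copula_def erlang_CDF_0 F.cdf_eq_0 max_def)
    finally show ?thesis using G by (simp add: measure_le_0_iff)
  qed (use quadrant in auto)
  show ?thesis
  proof (rule measure_eqI_atMost_rectangles)
    have mass: "emeasure (density Q (\<lambda>\<omega>. indicator {\<omega> \<in> space M. Y (Suc n) \<omega> = j} \<omega>)) C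
        = emeasure Q ({\<omega> \<in> space M. Y (Suc n) \<omega> = j} \<inter> C)" if "C \<in> sets M" for C
      using that by (intro emeasure_restricted) auto
    show "finite_measure ?\<mu>"
      unfolding Q_def[symmetric]
    proof (rule finite_measure.finite_measure_distr)
      show "finite_measure (density Q (\<lambda>\<omega>. indicator {\<omega> \<in> space M. Y (Suc n) \<omega> = j} \<omega>))"
        by (rule finite_measureI) (simp add: mass)
    qed measurable
    show "sets ?\<mu> = sets (borel \<Otimes>\<^sub>M borel)" by simp
    show "sets ?\<nu> = sets (borel \<Otimes>\<^sub>M borel)" by (subst sets_density) (intro sets_pair_measure_cong, simp_all)
    fix x y
    have "emeasure ?\<mu> ({..x} \<times> {..y})
       = emeasure (density Q (\<lambda>\<omega>. indicator {\<omega> \<in> space M. Y (Suc n) \<omega> = j} \<omega>))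
           {\<omega> \<in> space M. A (Suc n) \<omega> \<le> x \<and> S n \<omega> \<le> y}"
      unfolding Q_def[symmetric]
      by (subst emeasure_distr) (auto intro!: pair_measureI arg_cong2[where f = emeasure])
    also have "\<dots> = emeasure Q (R x y)"
      by (subst mass) (auto simp: R_def intro!: arg_cong2[where f = emeasure])
    also have "\<dots> = ennreal (P $ i $ j * ?G x y)"
      by (simp add: Q.emeasure_eq_measure law)
    also have "\<dots> = emeasure ?\<nu> ({..x} \<times> {..y})"
      by (rule F.emeasure_fgm_density_rectangle[OF lam_pos theta P_nonneg, symmetric])
    finally show "emeasure ?\<mu> ({..x} \<times> {..y}) = emeasure ?\<nu> ({..x} \<times> {..y})" .
  qed
qed

text \<open>
  \<open>W n\<close> is determined by the past, so the independence of the past and the triple makes the joint law a product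
  and allows Fubini's theorem.
\<close>

lemma distr_workload_triple_eq_product:
  fixes n i
  defines "Q \<equiv> uniform_measure M {\<omega> \<in> space M. Y n \<omega> = i}"
    and "N \<equiv> borel \<Otimes>\<^sub>M borel \<Otimes>\<^sub>M count_space UNIV"
    and "T \<equiv> \<lambda>\<omega>. (A (Suc n) \<omega>, S n \<omega>, Y (Suc n) \<omega>)"
  assumes pos: "0 < prob {\<omega> \<in> space M. Y n \<omega> = i}"
  shows "distr Q borel (W n) \<Otimes>\<^sub>M distr Q N T = distr Q (borel \<Otimes>\<^sub>M N) (\<lambda>\<omega>. (W n \<omega>, T \<omega>))"
proof -
  have [measurable_cong, simp]: "sets Q = sets M" "space Q = space M" by (simp_all add: Q_def)
  interpret Q: prob_space Q
    unfolding Q_def by (rule prob_space_uniform_measure) (use pos in \<open>auto simp: emeasure_eq_measure\<close>)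
  have [measurable]: "T \<in> measurable M N" unfolding T_def N_def by measurable
  interpret DW: prob_space "distr Q borel (W n)" by (rule Q.prob_space_distr) measurable
  interpret DT: prob_space "distr Q N T" by (rule Q.prob_space_distr) measurable
  show ?thesis
  proof (rule pair_measure_eqI)
    fix B C assume "B \<in> sets (distr Q borel (W n))" "C \<in> sets (distr Q N T)"
    then have B [measurable]: "B \<in> sets borel" and C [measurable]: "C \<in> sets N" by simp_all
    have past: "W n -` B \<inter> space M \<in> past_events M W S A Y n"
      unfolding past_events_def using B by (intro sigma_sets.Basic UnI1) blast
    have triple: "T -` C \<inter> space M \<in> triple_events M S A Y n"
      unfolding triple_events_def using C by (auto simp: T_def N_def)
    have eq: "(\<lambda>\<omega>. (W n \<omega>, T \<omega>)) -` (B \<times> C) \<inter> space M = (W n -` B \<inter> space M) \<inter> (T -` C \<inter> space M)"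
      by auto
    have "Q.prob ((\<lambda>\<omega>. (W n \<omega>, T \<omega>)) -` (B \<times> C) \<inter> space M)
        = Q.prob (W n -` B \<inter> space M) * Q.prob (T -` C \<inter> space M)"
      unfolding eq by (rule Q.indep_setD[OF cond_indep[OF pos, folded Q_def] past triple])
    then show "emeasure (distr Q borel (W n)) B * emeasure (distr Q N T) C
        = emeasure (distr Q (borel \<Otimes>\<^sub>M N) (\<lambda>\<omega>. (W n \<omega>, T \<omega>))) (B \<times> C)"
      by (simp add: emeasure_distr Q.emeasure_eq_measure ennreal_mult)
  qed (simp_all add: DW.sigma_finite_measure_axioms DT.sigma_finite_measure_axioms cong: sets_pair_measure_cong)
qed

text \<open>
  Expectations over the triple are integrals against the FGM density, once the restriction to \<open>Y (n+1) = j\<close>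
  is moved into the measure as a density.
\<close>

lemma conditional_expectation_eq_fgm_integral:
  assumes pos: "0 < prob {\<omega> \<in> space M. Y n \<omega> = i}"
    and h: "case_prod h \<in> borel_measurable (borel \<Otimes>\<^sub>M borel)"
  shows "(LINT \<omega>|uniform_measure M {\<omega> \<in> space M. Y n \<omega> = i}.
      h (A (Suc n) \<omega>) (S n \<omega>) * of_bool (Y (Suc n) \<omega> = j))
    = of_real (P $ i $ j) * (LINT (x, y)|(lborel \<Otimes>\<^sub>M lborel). of_real (fgm_density \<theta> (f i) (lam j) x y) * (h x y :: complex))"
proof -
  interpret F: lifetime_density "f i" by (rule lifetime)
  note [measurable] = h
  define Q where "Q = uniform_measure M {\<omega> \<in> space M. Y n \<omega> = i}"
  have [measurable_cong, simp]: "sets Q = sets M" "space Q = space M" by (simp_all add: Q_def)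
  let ?J = "{\<omega> \<in> space M. Y (Suc n) \<omega> = j}"
  have P_nonneg: "0 \<le> P $ i $ j" using stochastic unfolding stochastic_matrix_def by blast
  have "(LINT \<omega>|Q. h (A (Suc n) \<omega>) (S n \<omega>) * of_bool (Y (Suc n) \<omega> = j))
      = (LINT \<omega>|Q. indicator ?J \<omega> *\<^sub>R h (A (Suc n) \<omega>) (S n \<omega>))"
    by (rule Bochner_Integration.integral_cong) (auto split: split_indicator)
  also have "\<dots> = (LINT \<omega>|density Q (\<lambda>\<omega>. ennreal (indicator ?J \<omega>)). h (A (Suc n) \<omega>) (S n \<omega>))"
    by (rule integral_density[symmetric]) auto
  also have "\<dots> = (LINT z|distr (density Q (\<lambda>\<omega>. ennreal (indicator ?J \<omega>))) (borel \<Otimes>\<^sub>M borel)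
      (\<lambda>\<omega>. (A (Suc n) \<omega>, S n \<omega>)). case_prod h z)"
    by (subst integral_distr) auto
  also have "\<dots> = (LINT z|density (lborel \<Otimes>\<^sub>M lborel)
      (\<lambda>(x, y). ennreal (P $ i $ j * fgm_density \<theta> (f i) (lam j) x y)). case_prod h z)"
    using conditional_law_eq_density[OF pos, of j] by (simp add: Q_def ennreal_indicator)
  also have "\<dots> = (LINT z|(lborel \<Otimes>\<^sub>M lborel).
      (case z of (x, y) \<Rightarrow> P $ i $ j * fgm_density \<theta> (f i) (lam j) x y) *\<^sub>R case_prod h z)"
    unfolding case_prod_unfold
    by (rule integral_density) (auto simp: P_nonneg F.fgm_density_nonneg lam_pos theta)
  also have "\<dots> = (LINT z|(lborel \<Otimes>\<^sub>M lborel). of_real (P $ i $ j) *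
      (case z of (x, y) \<Rightarrow> of_real (fgm_density \<theta> (f i) (lam j) x y) * h x y))"
    by (rule Bochner_Integration.integral_cong) (auto simp: scaleR_conv_of_real mult.assoc)
  finally show ?thesis by (simp add: Q_def)
qed

lemma joint_transform_eq_conditional:
  assumes "0 < prob {\<omega> \<in> space M. Y n \<omega> = i}"
  shows "joint_transform M (W n) (Y n) i r
    = of_real (prob {\<omega> \<in> space M. Y n \<omega> = i}) *
      (LINT \<omega>|uniform_measure M {\<omega> \<in> space M. Y n \<omega> = i}. exp (- r * of_real (W n \<omega>)))"
  using integral_uniform_measure_times_prob[OF _ assms, of "\<lambda>\<omega>. exp (- r * of_real (W n \<omega>))"]
  unfolding joint_transform_def
  by (auto intro!: Bochner_Integration.integral_cong)

text \<open>
  The contribution of a transition from \<open>i\<close> to \<open>j\<close> to the right-hand side of the fixed-point equation, for an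
  arbitrary family \<open>z\<close>, so that it applies both to the transforms at time \<open>n\<close> and to their limits.
\<close>

definition transition_term :: "'n \<Rightarrow> 'n \<Rightarrow> complex \<Rightarrow> ('n \<Rightarrow> complex \<Rightarrow> complex) \<Rightarrow> complex" where
  "transition_term i j s z = of_real (P $ i $ j) *
     (of_real (lam j) / (of_real (lam j) - s) *
        (beta_star f i s - of_real \<theta> * s / (of_real (2 * lam j) - s) * g_star f i s) *
        z i (of_real a * s)
      - s * (of_real \<theta> / (of_real (2 * lam j) - s) * g_star f i (of_real (2 * lam j)) *
               z i (of_real (2 * a * lam j))
             + (beta_star f i (of_real (lam j)) - of_real \<theta> * g_star f i (of_real (lam j))) /
               (of_real (lam j) - s) * z i (of_real (a * lam j))))"

text \<open>
  The one-step identity, transition by transition. A state \<open>i\<close> of probability zero at time \<open>n\<close> makes both sides zero;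
  otherwise the expectation is taken under the measure conditioned on \<open>Y n = i\<close>, first over the triple for a fixed
  workload \<open>w\<close>, then over \<open>w\<close>.
\<close>

lemma transition_transform:
  assumes s: "0 \<le> Re s" "s \<noteq> of_real (lam j)" "s \<noteq> of_real (2 * lam j)"
  shows "(LINT \<omega>|M. exp (- s * of_real (W (Suc n) \<omega>)) * of_bool (Y (Suc n) \<omega> = j) * of_bool (Y n \<omega> = i))
    = transition_term i j s (joint_transform M (W n) (Y n))"
proof (cases "0 < prob {\<omega> \<in> space M. Y n \<omega> = i}")
  case False
  then have "AE \<omega> in M. \<not> (Y n \<omega> = i)"
    by (subst (asm) zero_less_measure_iff) (auto simp: emeasure_eq_measure prob_eq_0)
  then have "(LINT \<omega>|M. exp (- s * of_real (W (Suc n) \<omega>)) * of_bool (Y (Suc n) \<omega> = j) * of_bool (Y n \<omega> = i)) = 0"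
    "joint_transform M (W n) (Y n) i r = 0" for r
    unfolding joint_transform_def by (auto intro!: integral_eq_zero_AE)
  then show ?thesis by (simp add: transition_term_def)
next
  case True
  interpret F: lifetime_density "f i" by (rule lifetime)
  define B where "B = {\<omega> \<in> space M. Y n \<omega> = i}"
  define Q where "Q = uniform_measure M B"
  define N where "N = (borel \<Otimes>\<^sub>M borel \<Otimes>\<^sub>M count_space UNIV :: (real \<times> real \<times> 'n) measure)"
  define T where "T \<omega> = (A (Suc n) \<omega>, S n \<omega>, Y (Suc n) \<omega>)" for \<omega>
  have B [measurable]: "B \<in> sets M" unfolding B_def by measurable
  have posB: "0 < prob B" using True by (simp add: B_def)
  have [measurable_cong, simp]: "sets Q = sets M" "space Q = space M" by (simp_all add: Q_def)
  interpret Q: prob_space Q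
    unfolding Q_def by (rule prob_space_uniform_measure) (use posB in \<open>auto simp: emeasure_eq_measure\<close>)
  have T [measurable]: "T \<in> measurable Q N" unfolding T_def[abs_def] N_def by measurable
  have W [measurable]: "W n \<in> borel_measurable Q" by measurable
  define H where "H w t = exp (- s * complex_of_real (max 0 (a * w + fst (snd t) - fst t))) * of_bool (snd (snd t) = j)"
    for w and t :: "real \<times> real \<times> 'n"
  have H [measurable]: "case_prod H \<in> borel_measurable (borel \<Otimes>\<^sub>M N)"
    unfolding H_def N_def by measurable
  have H_le: "norm (H w t) \<le> 1" for w t
    using norm_exp_neg_mult_le_1[OF s(1), of "max 0 (a * w + fst (snd t) - fst t)"]
    by (auto simp: H_def norm_mult of_bool_def)
  interpret DW: prob_space "distr Q borel (W n)" by (rule Q.prob_space_distr) measurable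
  interpret DT: prob_space "distr Q N T" by (rule Q.prob_space_distr) measurable
  interpret D: pair_prob_space "distr Q borel (W n)" "distr Q N T" ..
  have indep: "distr Q borel (W n) \<Otimes>\<^sub>M distr Q N T = distr Q (borel \<Otimes>\<^sub>M N) (\<lambda>\<omega>. (W n \<omega>, T \<omega>))"
    using distr_workload_triple_eq_product[OF True] by (simp add: Q_def B_def N_def T_def[abs_def])

  define c where "c = of_real (lam j) / (of_real (lam j) - s) *
      (beta_star f i s - of_real \<theta> * s / (of_real (2 * lam j) - s) * g_star f i s)"
  define c2 where "c2 = of_real \<theta> / (of_real (2 * lam j) - s) * g_star f i (of_real (2 * lam j))"
  define c1 where "c1 = (beta_star f i (of_real (lam j)) - of_real \<theta> * g_star f i (of_real (lam j))) / (of_real (lam j) - s)"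
  have tilted: "tilted_density (f i) = (\<lambda>y. f i y * (1 - 2 * density_cdf (f i) y))"
    by (simp add: fun_eq_iff tilted_density_def)
  \<comment> \<open>Averaging \<open>E r (W n)\<close> over \<open>Y n = i\<close> gives the transform at \<open>a * r\<close>.\<close>
  define E where "E r w = exp (- (of_real a * r) * complex_of_real w)" for r w
  have inner: "(LINT t|distr Q N T. H w t)
      = of_real (P $ i $ j) * (c * E s w - s * (c2 * E (of_real (2 * lam j)) w + c1 * E (of_real (lam j)) w))"
    if w: "0 \<le> w" for w
  proof -
    let ?h = "\<lambda>x y. exp (- s * complex_of_real (max 0 (a * w + y - x)))"
    have aw: "0 \<le> a * w" using a w by simp
    have "(LINT t|distr Q N T. H w t) = (LINT \<omega>|Q. H w (T \<omega>))"
      by (rule integral_distr) measurable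
    also have "\<dots> = (LINT \<omega>|Q. ?h (A (Suc n) \<omega>) (S n \<omega>) * of_bool (Y (Suc n) \<omega> = j))"
      by (simp add: H_def T_def)
    also have "\<dots> = of_real (P $ i $ j) *
        (LINT (x, y)|(lborel \<Otimes>\<^sub>M lborel). of_real (fgm_density \<theta> (f i) (lam j) x y) * ?h x y)"
      unfolding Q_def B_def by (rule conditional_expectation_eq_fgm_integral[OF True]) measurable
    also have "(LINT (x, y)|(lborel \<Otimes>\<^sub>M lborel). of_real (fgm_density \<theta> (f i) (lam j) x y) * ?h x y)
        = c * E s w - s * (c2 * E (of_real (2 * lam j)) w + c1 * E (of_real (lam j)) w)"
      unfolding F.integral_fgm_density_waiting[OF lam_pos s aw]
      by (simp add: c_def c2_def c1_def E_def beta_star_def g_star_def tilted mult_ac)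
    finally show ?thesis .
  qed
  have E_int: "integrable Q (\<lambda>\<omega>. E r (W n \<omega>))" "of_real (prob B) * (LINT \<omega>|Q. E r (W n \<omega>)) = joint_transform M (W n) (Y n) i (of_real a * r)"
    if "0 \<le> Re r" for r
  proof -
    have "AE \<omega> in Q. 0 \<le> W n \<omega>"
      unfolding Q_def by (rule AE_uniform_measureI) (use W_nonneg[of n] in auto)
    then have "AE \<omega> in Q. norm (E r (W n \<omega>)) \<le> 1"
      by eventually_elim (use a that in \<open>simp add: E_def\<close>)
    moreover have "(\<lambda>\<omega>. E r (W n \<omega>)) \<in> borel_measurable Q"
      unfolding E_def by measurable
    ultimately show "integrable Q (\<lambda>\<omega>. E r (W n \<omega>))"
      by (rule Q.integrable_const_bound)
    show "of_real (prob B) * (LINT \<omega>|Q. E r (W n \<omega>)) = joint_transform M (W n) (Y n) i (of_real a * r)"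
      unfolding joint_transform_eq_conditional[OF True] by (simp add: E_def Q_def B_def)
  qed
  have re: "0 \<le> Re (complex_of_real (lam j))" "0 \<le> Re (complex_of_real (2 * lam j))"
    using lam_pos[of j] by auto
  have "(LINT \<omega>|M. exp (- s * of_real (W (Suc n) \<omega>)) * of_bool (Y (Suc n) \<omega> = j) * of_bool (Y n \<omega> = i))
    = of_real (prob B) * (LINT \<omega>|Q. exp (- s * of_real (W (Suc n) \<omega>)) * of_bool (Y (Suc n) \<omega> = j))"
    unfolding Q_def
    by (subst integral_uniform_measure_times_prob[OF B posB], measurable)
      (auto intro!: Bochner_Integration.integral_cong simp: B_def)
  also have "(LINT \<omega>|Q. exp (- s * of_real (W (Suc n) \<omega>)) * of_bool (Y (Suc n) \<omega> = j))
    = (LINT \<omega>|Q. H (W n \<omega>) (T \<omega>))"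
  proof (rule integral_cong_AE)
    have "AE \<omega> in Q. W (Suc n) \<omega> = max 0 (a * W n \<omega> + S n \<omega> - A (Suc n) \<omega>)"
      unfolding Q_def by (rule AE_uniform_measureI) (use recursion[of n] in auto)
    then show "AE \<omega> in Q. exp (- s * of_real (W (Suc n) \<omega>)) * of_bool (Y (Suc n) \<omega> = j) = H (W n \<omega>) (T \<omega>)"
      by eventually_elim (simp add: H_def T_def)
  qed measurable
  also have "\<dots> = (LINT z|distr Q (borel \<Otimes>\<^sub>M N) (\<lambda>\<omega>. (W n \<omega>, T \<omega>)). case_prod H z)"
    by (subst integral_distr) auto
  also have "\<dots> = (LINT w|distr Q borel (W n). LINT t|distr Q N T. H w t)"
    unfolding indep[symmetric]
    by (rule D.integral_fst[symmetric], rule D.integrable_const_bound[where B = 1])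
      (use H_le in auto)
  also have "\<dots> = (LINT \<omega>|Q. LINT t|distr Q N T. H (W n \<omega>) t)"
    by (rule integral_distr) measurable
  also have "\<dots> = (LINT \<omega>|Q. of_real (P $ i $ j) *
      (c * E s (W n \<omega>) - s * (c2 * E (of_real (2 * lam j)) (W n \<omega>) + c1 * E (of_real (lam j)) (W n \<omega>))))"
  proof (rule integral_cong_AE)
    have "AE \<omega> in Q. 0 \<le> W n \<omega>"
      unfolding Q_def by (rule AE_uniform_measureI) (use W_nonneg[of n] in auto)
    then show "AE \<omega> in Q. (LINT t|distr Q N T. H (W n \<omega>) t) = of_real (P $ i $ j) *
      (c * E s (W n \<omega>) - s * (c2 * E (of_real (2 * lam j)) (W n \<omega>) + c1 * E (of_real (lam j)) (W n \<omega>)))"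
      by eventually_elim (rule inner)
    show "(\<lambda>\<omega>. of_real (P $ i $ j) *
      (c * E s (W n \<omega>) - s * (c2 * E (of_real (2 * lam j)) (W n \<omega>) + c1 * E (of_real (lam j)) (W n \<omega>))))
      \<in> borel_measurable Q"
      unfolding E_def by measurable
  qed measurable
  also have "\<dots> = of_real (P $ i $ j) * (c * (LINT \<omega>|Q. E s (W n \<omega>))
      - s * (c2 * (LINT \<omega>|Q. E (of_real (2 * lam j)) (W n \<omega>)) + c1 * (LINT \<omega>|Q. E (of_real (lam j)) (W n \<omega>))))"
    using E_int(1)[OF s(1)] E_int(1)[OF re(1)] E_int(1)[OF re(2)] by simp
  also have "of_real (prob B) * \<dots> = of_real (P $ i $ j) * (c * (of_real (prob B) * (LINT \<omega>|Q. E s (W n \<omega>)))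
      - s * (c2 * (of_real (prob B) * (LINT \<omega>|Q. E (of_real (2 * lam j)) (W n \<omega>)))
        + c1 * (of_real (prob B) * (LINT \<omega>|Q. E (of_real (lam j)) (W n \<omega>)))))"
    by (simp add: algebra_simps)
  also have "\<dots> = transition_term i j s (joint_transform M (W n) (Y n))"
    unfolding E_int(2)[OF s(1)] E_int(2)[OF re(1)] E_int(2)[OF re(2)]
    by (simp add: transition_term_def c_def c2_def c1_def mult_ac)
  finally show ?thesis .
qed

lemma joint_transform_Suc:
  assumes s: "0 \<le> Re s" "s \<noteq> of_real (lam j)" "s \<noteq> of_real (2 * lam j)"
  shows "joint_transform M (W (Suc n)) (Y (Suc n)) j s = (\<Sum>i\<in>UNIV. transition_term i j s (joint_transform M (W n) (Y n)))"
proof -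
  have int: "integrable M (\<lambda>\<omega>. exp (- s * of_real (W (Suc n) \<omega>)) * of_bool (Y (Suc n) \<omega> = j) * of_bool (Y n \<omega> = i))" for i
  proof (rule integrable_const_bound[where B = 1])
    show "AE \<omega> in M. norm (exp (- s * of_real (W (Suc n) \<omega>)) * of_bool (Y (Suc n) \<omega> = j) * of_bool (Y n \<omega> = i)) \<le> 1"
      using W_nonneg[of "Suc n"]
      by eventually_elim (use s in \<open>auto simp: norm_mult of_bool_def\<close>)
  qed measurable
  have "joint_transform M (W (Suc n)) (Y (Suc n)) j s
    = (LINT \<omega>|M. (\<Sum>i\<in>UNIV. exp (- s * of_real (W (Suc n) \<omega>)) * of_bool (Y (Suc n) \<omega> = j) * of_bool (Y n \<omega> = i)))"
    unfolding joint_transform_def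
    by (rule Bochner_Integration.integral_cong) (simp_all add: of_bool_def sum_distrib_left[symmetric])
  also have "\<dots> = (\<Sum>i\<in>UNIV. transition_term i j s (joint_transform M (W n) (Y n)))"
    unfolding transition_transform[OF s, symmetric]
    by (rule Bochner_Integration.integral_sum) (rule int)
  finally show ?thesis .
qed

end

section \<open>The stationary equation and its matrix form\<close>

lemma (in fgm_queue_steady) Z_eq: "0 \<le> Re s \<Longrightarrow> Z M W Y i s = joint_transform M' Winf Yinf i s"
  unfolding Z_def by (rule limI) (rule transform_limit)

text \<open>
  The right-hand side involves only transforms at arguments with nonnegative real part, where they converge.
\<close>

lemma (in fgm_queue_steady) Z_fixed_point:
  assumes s: "0 \<le> Re s" "s \<noteq> of_real (lam j)" "s \<noteq> of_real (2 * lam j)"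
  shows "Z M W Y j s = (\<Sum>i\<in>UNIV. transition_term i j s (Z M W Y))"
proof (rule LIMSEQ_unique)
  have lim: "(\<lambda>n. joint_transform M (W n) (Y n) i r) \<longlonglongrightarrow> Z M W Y i r" if "0 \<le> Re r" for i r
    using transform_limit[OF that] Z_eq[OF that] by simp
  show "(\<lambda>n. joint_transform M (W (Suc n)) (Y (Suc n)) j s) \<longlonglongrightarrow> Z M W Y j s"
    by (rule LIMSEQ_Suc) (rule lim[OF s(1)])
  have "0 \<le> Re (of_real a * s)" "0 \<le> Re (complex_of_real (2 * a * lam j))" "0 \<le> Re (complex_of_real (a * lam j))"
    using a s lam_pos[of j] by auto
  then show "(\<lambda>n. joint_transform M (W (Suc n)) (Y (Suc n)) j s) \<longlonglongrightarrow> (\<Sum>i\<in>UNIV. transition_term i j s (Z M W Y))"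
    unfolding joint_transform_Suc[OF s] transition_term_def
    by (intro tendsto_intros lim)
qed

lemma diag_matrix_mult_left: "(diag_matrix d ** X) $ i $ j = d i * X $ i $ j"
  by (simp add: matrix_matrix_mult_def diag_matrix_def if_distrib[of "\<lambda>x. x * _"] cong: if_cong)

lemma diag_matrix_mult_right: "(X ** diag_matrix d) $ i $ j = X $ i $ j * d j"
  by (simp add: matrix_matrix_mult_def diag_matrix_def if_distrib[of "\<lambda>x. _ * x"] cong: if_cong)

lemma diag_matrix_mult_vector: "(diag_matrix d *v x) $ i = d i * x $ i"
  by (simp add: matrix_vector_mult_def diag_matrix_def if_distrib[of "\<lambda>x. x * _"] cong: if_cong)

lemma mat_1_minus_diag_matrix: "mat 1 - diag_matrix d = diag_matrix (\<lambda>i. 1 - d i)"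
  by (simp add: vec_eq_iff mat_def diag_matrix_def)

lemma (in fgm_queue) sum_transition_term:
  "(\<Sum>i\<in>UNIV. transition_term i j s z) =
     of_real (lam j) / (of_real (lam j) - s) *
        (\<Sum>i\<in>UNIV. of_real (P $ i $ j) *
          (beta_star f i s - of_real \<theta> * s / (of_real (2 * lam j) - s) * g_star f i s) * z i (of_real a * s))
      - s * (\<Sum>i\<in>UNIV. of_real (P $ i $ j) *
          (of_real \<theta> / (of_real (2 * lam j) - s) * g_star f i (of_real (2 * lam j)) * z i (of_real (2 * a * lam j))
           + (beta_star f i (of_real (lam j)) - of_real \<theta> * g_star f i (of_real (lam j)))
               / (of_real (lam j) - s) * z i (of_real (a * lam j))))"
  unfolding transition_term_def sum_distrib_left sum_subtractf[symmetric]
  by (rule sum.cong) (simp_all add: right_diff_distrib mult_ac)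

text \<open>
  The entries of \<open>U\<close> and \<open>K\<close> match because \<open>1 - k \<lambda> / (k \<lambda> - s) = - s / (k \<lambda> - s)\<close>
  for \<open>k = 1, 2\<close>, which is what the factors \<open>I - L\<close> contribute.
\<close>

lemma (in fgm_queue) sum_transition_term_eq_matrix:
  assumes s: "s \<noteq> of_real (lam j)" "s \<noteq> of_real (2 * lam j)"
  shows "(\<Sum>i\<in>UNIV. transition_term i j s z) = (U \<theta> P f lam s *v (\<chi> i. z i (of_real a * s)) + K a \<theta> P f lam z s) $ j"
proof -
  have ne: "complex_of_real (lam j) - s \<noteq> 0" "2 * complex_of_real (lam j) - s \<noteq> 0"
    using s by auto
  define r1 where "r1 = s / (complex_of_real (lam j) - s)"
  define r2 where "r2 = s / (2 * complex_of_real (lam j) - s)"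
  define l where "l = complex_of_real (lam j) / (complex_of_real (lam j) - s)"
  have r1: "1 - complex_of_real (lam j) / (complex_of_real (lam j) - s) = - r1"
    using ne(1) by (simp add: r1_def divide_simps)
  have r2: "1 - 2 * complex_of_real (lam j) / (2 * complex_of_real (lam j) - s) = - r2"
    using ne(2) by (simp add: r2_def divide_simps)
  have U: "(U \<theta> P f lam s *v (\<chi> i. z i (of_real a * s))) $ j
     = (\<Sum>i\<in>UNIV. l * (of_real (P $ i $ j) * beta_star f i s
          + of_real \<theta> * (- r2 * of_real (P $ i $ j) * g_star f i s)) * z i (of_real a * s))"
    unfolding matrix_vector_mult_def U_def Let_def L_def B_star_def G_star_def mat_1_minus_diag_matrix
    by (simp add: diag_matrix_mult_left diag_matrix_mult_right transpose_def map_matrix_def r2)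
      (simp add: scaleR_conv_of_real l_def)
  have K: "K a \<theta> P f lam z s $ j = - r1 * v1 a \<theta> P f lam z $ j + - r2 * v2 a \<theta> P f lam z $ j"
    unfolding K_def L_def mat_1_minus_diag_matrix
    by (simp add: diag_matrix_mult_vector r1 r2)
  have "(\<Sum>i\<in>UNIV. transition_term i j s z) = (\<Sum>i\<in>UNIV. l * (of_real (P $ i $ j) * beta_star f i s
          + of_real \<theta> * (- r2 * of_real (P $ i $ j) * g_star f i s)) * z i (of_real a * s)
      + (- r1 * (of_real (P $ i $ j) *
          (beta_star f i (of_real (lam j)) - of_real \<theta> * g_star f i (of_real (lam j))) * z i (of_real (a * lam j)))
        + - r2 * (of_real \<theta> * (of_real (P $ i $ j) * g_star f i (of_real (2 * lam j)) * z i (of_real (2 * a * lam j))))))"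
    by (rule sum.cong) (simp_all add: transition_term_def r1_def r2_def l_def algebra_simps diff_divide_distrib)
  also have "\<dots> = (U \<theta> P f lam s *v (\<chi> i. z i (of_real a * s)) + K a \<theta> P f lam z s) $ j"
    unfolding vector_add_component U K v1_def v2_def sum.distrib vec_lambda_beta sum_distrib_left ..
  finally show ?thesis .
qed

theorem theorem8:
  fixes M :: "'a measure" and M' :: "'b measure"
    and a \<theta> :: real
    and P :: "real ^ 'n ^ 'n"
    and p :: "real ^ 'n"
    and f :: "'n \<Rightarrow> real \<Rightarrow> real"
    and lam :: "'n \<Rightarrow> real"
    and W S A :: "nat \<Rightarrow> 'a \<Rightarrow> real"
    and Y :: "nat \<Rightarrow> 'a \<Rightarrow> 'n"
    and Winf :: "'b \<Rightarrow> real"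
    and Yinf :: "'b \<Rightarrow> 'n"
    and s :: complex
  assumes "fgm_queue_steady M a \<theta> P p f lam W S A Y M' Winf Yinf"
    and "0 \<le> Re s"
    and "\<forall>k. s \<noteq> complex_of_real (lam k) \<and> s \<noteq> complex_of_real (2 * lam k)"
  shows "(\<forall>j. Z M W Y j s =
      complex_of_real (lam j) / (complex_of_real (lam j) - s) *
        (\<Sum>i\<in>UNIV. complex_of_real (P $ i $ j) *
          (beta_star f i s
            - complex_of_real \<theta> * s / (complex_of_real (2 * lam j) - s) * g_star f i s) *
          Z M W Y i (complex_of_real a * s))
      - s * (\<Sum>i\<in>UNIV. complex_of_real (P $ i $ j) *
          (complex_of_real \<theta> / (complex_of_real (2 * lam j) - s) *
             g_star f i (complex_of_real (2 * lam j)) * Z M W Y i (complex_of_real (2 * a * lam j))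
           + (beta_star f i (complex_of_real (lam j))
                - complex_of_real \<theta> * g_star f i (complex_of_real (lam j)))
               / (complex_of_real (lam j) - s) * Z M W Y i (complex_of_real (a * lam j)))))
    \<and> (\<chi> j. Z M W Y j s) =
        U \<theta> P f lam s *v (\<chi> j. Z M W Y j (complex_of_real a * s)) + K a \<theta> P f lam (Z M W Y) s"
proof -
  interpret fgm_queue_steady M a \<theta> P p f lam W S A Y M' Winf Yinf by fact
  have fixed_point: "Z M W Y j s = (\<Sum>i\<in>UNIV. transition_term i j s (Z M W Y))" for j
    using assms(2,3) by (intro Z_fixed_point) auto
  have "(\<chi> j. Z M W Y j s) =
      U \<theta> P f lam s *v (\<chi> j. Z M W Y j (complex_of_real a * s)) + K a \<theta> P f lam (Z M W Y) s"
  proof (rule iffD2[OF vec_eq_iff], rule allI)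
    fix j
    show "(\<chi> j. Z M W Y j s) $ j =
      (U \<theta> P f lam s *v (\<chi> j. Z M W Y j (complex_of_real a * s)) + K a \<theta> P f lam (Z M W Y) s) $ j"
      using assms(3) by (simp only: vec_lambda_beta fixed_point) (rule sum_transition_term_eq_matrix, auto)
  qed
  then show ?thesis
    using fixed_point sum_transition_term by simp
qed

end
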